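(* Let $n\ge1$ and let $\phi:S_n\to\mathcal{L}(\mathcal{H})$ be a positive definite function with $\phi(e)=I_{\mathcal{H}}$. The central extension $\Phi:\mathbb{F}\to\mathcal{L}(\mathcal{H})$ of $\phi$ does not depend on the lexicographic order considered on $\mathbb{F}$, and it is a maximal $n+1$ orthogonal extension of $\phi$.
   Context: $\mathcal{H}$ is a Hilbert space, $\mathcal{L}(\mathcal{H})$ its bounded operators. $\mathbb{F}$ is the free group with finitely many generators $a_1,\dots,a_m$; $\mathcal{A}=\{a_1,\dots,a_m\}$; $e$ is the unit; words are written in reduced form over $\mathcal{A}\cup\mathcal{A}^{-1}$, $|s|$ is the reduced length of $s$, and $S_n=\{s\in\mathbb{F}:|s|\le n\}$. $\mathrm{CB}(s,t)$ denotes the longest common initial segment of the reduced words $s,t$. A total order $\preceq$ on $\mathbb{F}$ is called lexicographic if $s_1\preceq s_2$ whenever either $|s_1|<|s_2|$, or $|s_1|=|s_2|$ and, with $t=\mathrm{CB}(s_1,s_2)$ and $b_i$ the first letter of $t^{-1}s_i$, one has $b_1\preceq b_2$. Given such an order, $\hat{\mathbb{F}}$ is the set of classes $\hat s=\{s,s^{-1}\}$, ordered by $\hat s\preceq\hat t$ iff $\min\{s,s^{-1}\}\preceq\min\{t,t^{-1}\}$; $\prec$ means $\preceq$ and $\ne$; $\mu^-$ is the predecessor of $\mu$ in $\hat{\mathbb{F}}$. For $\mu\in\hat{\mathbb{F}}$ put $\Sigma_\mu=\bigcup_{\mu'\preceq\mu}\mu'\subset\mathbb{F}$; thus $S_n=\Sigma_{\nu_n}$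 where $\nu_n$ is the last class of words of length $n$. $\Gamma_\mu$ is the graph with vertex set $\mathbb{F}$ in which distinct $s,t$ are adjacent iff $\widehat{s^{-1}t}\preceq\mu$. For $\Sigma=\Sigma^{-1}\subset\mathbb{F}$, a function $\phi:\Sigma\to\mathcal{L}(\mathcal{H})$ is positive definite if for all $s_1,\dots,s_k\in\mathbb{F}$ with $s_i^{-1}s_j\in\Sigma$ for all $i,j$, the operator matrix $[\phi(s_i^{-1}s_j)]_{i,j=1}^k$ is positive semidefinite. For finite $S\subset\mathbb{F}$ with $s^{-1}t\in\Sigma$ for all $s,t\in S$, $A(\phi;S)=[\phi(s^{-1}t)]_{s,t\in S}$. Realizations: for a positive semidefinite block operator matrix $A=(A_{ij})_{i,j\in I}$ with entries in $\mathcal{L}(\mathcal{H})$, $\mathcal{R}(A)$ is the (essentially unique) Hilbert space with operators $\omega_i:\mathcal{H}\to\mathcal{R}(A)$ (isometries if $A_{ii}=I$) such that $A_{ij}=\omega_i^*\omega_j$ and the ranges $\omega_i\mathcal{H}$ span a dense subspace; it is $\{0\}$ if $I=\emptyset$. For $J\subset I$, $\mathcal{R}(A|J)$ (with $A|J$ the submatrix with rows and columns in $J$) is identified with the closed span of $\omega_i\mathcal{H}$, $i\in J$, in $\mathcal{R}(A)$. Central extension: for $\mu\neq\{e\}$ write $\mu=\{s_\mu,s_\mu^{-1}\}$ with $s_\mu\preceq s_\mu^{-1}$, and let $C_\mu$ be the (unique, finite) maximal clique of $\Gamma_\mu$ containing $e$ and $s_\mu$. For a positive definite $\psi$ on $\Sigma_{\mu^-}$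 set $\boldsymbol{D}(\psi)=\mathcal{R}(A(\psi;C_\mu\setminus\{s_\mu\}))\ominus\mathcal{R}(A(\psi;C_\mu\setminus\{e,s_\mu\}))$ and $\boldsymbol{R}(\psi)=\mathcal{R}(A(\psi;C_\mu\setminus\{e\}))\ominus\mathcal{R}(A(\psi;C_\mu\setminus\{e,s_\mu\}))$. If $\Phi$ is positive definite on $\mathbb{F}$, then for $\psi=\Phi|\Sigma_{\mu^-}$ both are subspaces of $\mathcal{R}(A(\Phi;C_\mu))$ and $\gamma_\mu(\Phi)=P_{\boldsymbol{R}(\psi)}|_{\boldsymbol{D}(\psi)}$. Positive definite extensions $\Phi$ of $\phi$ to $\mathbb{F}$ correspond bijectively to sequences of contractions $(\gamma_\mu)_{\nu_n\prec\mu}$, $\gamma_\mu:\boldsymbol{D}(\Phi|\Sigma_{\mu^-})\to\boldsymbol{R}(\Phi|\Sigma_{\mu^-})$, via $\gamma_\mu=\gamma_\mu(\Phi)$. The central extension of $\phi$ (with respect to the given lexicographic order) is the one with $\gamma_\mu=0$ for all $\mu$ with $\nu_n\prec\mu$. Maximal orthogonality: let $\Phi$ be a positive definite extension of $\phi$ to $\mathbb{F}$ and $(\mathcal{K}_\Phi,\pi_\Phi,V_\Phi)$ its minimal Naimark dilation, i.e. $\pi_\Phi$ is a unitary representation of $\mathbb{F}$ on $\mathcal{K}_\Phi$, $V_\Phi:\mathcal{H}\to\mathcal{K}_\Phi$, $\Phi(s)=V_\Phi^*\pi_\Phi(s)V_\Phi$ for all $s$, and $\mathcal{K}_\Phi=\bigvee_{s\in\mathbb{F}}\pi_\Phi(s)V_\Phi\mathcal{H}$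 (closed span). For $\Sigma\subset\mathbb{F}$, $\mathcal{K}_\Phi(\Sigma)=\bigvee_{\sigma\in\Sigma}\pi_\Phi(\sigma)V_\Phi\mathcal{H}$. $\Phi$ is a maximal $n+1$ orthogonal extension of $\phi$ if whenever $s,t\in\mathbb{F}$, $|s^{-1}t|=n+1$ and $\Sigma=\{r\in\mathbb{F}:\max(|r^{-1}s|,|r^{-1}t|)\le n\}$, one has $\big(\mathcal{K}_\Phi(\Sigma\cup\{s\})\ominus\mathcal{K}_\Phi(\Sigma)\big)\perp\big(\mathcal{K}_\Phi(\Sigma\cup\{t\})\ominus\mathcal{K}_\Phi(\Sigma)\big)$. *)

theory Defs
  imports "HOL-Analysis.Analysis" "HOL-Library.Sublist"
begin

section \<open>Complex Hilbert spaces\<close>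

text \<open>The real inner product inherited from \<^class>\<open>real_inner\<close> is the real part of the complex one, so
  the norm is the usual Hilbert space norm. The complex inner product is linear in its first argument.\<close>

class chilbert_space = real_inner + complete_space +
  fixes scaleC :: "complex \<Rightarrow> 'a \<Rightarrow> 'a" (infixr \<open>*\<^sub>C\<close> 75)
    and cinner :: "'a \<Rightarrow> 'a \<Rightarrow> complex"
  assumes scaleC_add_right: "c *\<^sub>C (x + y) = c *\<^sub>C x + c *\<^sub>C y"
    and scaleC_add_left: "(c + d) *\<^sub>C x = c *\<^sub>C x + d *\<^sub>C x"
    and scaleC_scaleC: "c *\<^sub>C d *\<^sub>C x = (c * d) *\<^sub>C x"
    and scaleC_of_real: "complex_of_real r *\<^sub>C x = r *\<^sub>R x"
    and cinner_add_left: "cinner (x + y) z = cinner x z + cinner y z"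
    and cinner_scaleC_left: "cinner (c *\<^sub>C x) y = c * cinner x y"
    and cinner_commute: "cinner x y = cnj (cinner y x)"
    and Re_cinner: "Re (cinner x y) = x \<bullet> y"

lemma scaleC_one: "1 *\<^sub>C x = (x :: 'a::chilbert_space)"
  using scaleC_of_real[of 1 x] by simp

interpretation cspace: vector_space "scaleC :: complex \<Rightarrow> 'a \<Rightarrow> 'a::chilbert_space"
  by unfold_locales (simp_all add: scaleC_add_right scaleC_add_left scaleC_scaleC scaleC_one)

instantiation complex :: chilbert_space
begin

definition scaleC_complex :: "complex \<Rightarrow> complex \<Rightarrow> complex" where
  "scaleC_complex c x = c * x"

definition cinner_complex :: "complex \<Rightarrow> complex \<Rightarrow> complex" where
  "cinner_complex x y = x * cnj y"

instance
  by standard (simp_all add: scaleC_complex_def cinner_complex_def algebra_simps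
      inner_complex_def scaleR_conv_of_real)

end

definition closed_cspan :: "'k::chilbert_space set \<Rightarrow> 'k set" where
  "closed_cspan X = closure (cspace.span X)"

definition bounded_clinear :: "('h::chilbert_space \<Rightarrow> 'k::chilbert_space) \<Rightarrow> bool" where
  "bounded_clinear T \<longleftrightarrow> bounded_linear T \<and> (\<forall>c x. T (c *\<^sub>C x) = c *\<^sub>C T x)"

definition unitary :: "('k::chilbert_space \<Rightarrow> 'k) \<Rightarrow> bool" where
  "unitary U \<longleftrightarrow> bounded_clinear U \<and> surj U \<and> (\<forall>x y. cinner (U x) (U y) = cinner x y)"

definition orth_sets :: "'k::chilbert_space set \<Rightarrow> 'k set \<Rightarrow> bool" where
  "orth_sets X Y \<longleftrightarrow> (\<forall>x\<in>X. \<forall>y\<in>Y. cinner x y = 0)"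

definition orth_diff :: "'k::chilbert_space set \<Rightarrow> 'k set \<Rightarrow> 'k set" (infixl \<open>\<ominus>\<close> 65) where
  "M \<ominus> N = {x \<in> M. \<forall>y\<in>N. cinner x y = 0}"

text \<open>Orthogonal projection onto a closed subspace.\<close>

definition oproj :: "'k::chilbert_space set \<Rightarrow> 'k \<Rightarrow> 'k" where
  "oproj M x = (THE y. y \<in> M \<and> (\<forall>z\<in>M. cinner (x - y) z = 0))"


section \<open>Free groups\<close>

text \<open>The generators are the elements of a finite type; the letter \<^term>\<open>(a, True)\<close> stands for the
  generator \<open>a\<close> and \<^term>\<open>(a, False)\<close> for its inverse.\<close>

definition inv_letter :: "'a \<times> bool \<Rightarrow> 'a \<times> bool" where
  "inv_letter x = (fst x, \<not> snd x)"

abbreviation reduced :: "('a \<times> bool) list \<Rightarrow> bool" where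
  "reduced \<equiv> successively (\<lambda>x y. y \<noteq> inv_letter x)"

lemma inv_letter_inv_letter [simp]: "inv_letter (inv_letter x) = x"
  by (simp add: inv_letter_def)

lemma inv_letter_neq [simp]: "inv_letter x \<noteq> x"
  by (cases x) (simp add: inv_letter_def)

fun cancel_cons :: "'a \<times> bool \<Rightarrow> ('a \<times> bool) list \<Rightarrow> ('a \<times> bool) list" where
  "cancel_cons x [] = [x]"
| "cancel_cons x (y # w) = (if y = inv_letter x then w else x # y # w)"

lemma reduced_cancel_cons: "reduced w \<Longrightarrow> reduced (cancel_cons x w)"
  by (cases w) (auto simp: successively_Cons)

lemma reduced_foldr_cancel_cons: "reduced w \<Longrightarrow> reduced (foldr cancel_cons u w)"
  by (induction u) (auto simp: reduced_cancel_cons)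

lemma reduced_inverse: "reduced w \<Longrightarrow> reduced (rev (map inv_letter w))"
  by (simp add: successively_map, erule successively_mono) (metis inv_letter_inv_letter)

lemma cancel_cons_inv: "reduced w \<Longrightarrow> cancel_cons x (cancel_cons (inv_letter x) w) = w"
  by (cases w rule: remdups_adj.cases) auto

lemma foldr_cancel_cons_Cons:
  assumes "reduced u"
  shows "foldr cancel_cons (cancel_cons x w) u = cancel_cons x (foldr cancel_cons w u)"
  using assms cancel_cons_inv[OF reduced_foldr_cancel_cons[OF assms], of x]
  by (cases w) auto

lemma foldr_cancel_cons_assoc:
  "reduced u \<Longrightarrow> foldr cancel_cons (foldr cancel_cons s t) u
    = foldr cancel_cons s (foldr cancel_cons t u)"
  by (induction s) (simp_all add: foldr_cancel_cons_Cons)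

lemma foldr_cancel_cons_Nil: "reduced w \<Longrightarrow> foldr cancel_cons w [] = w"
proof (induction w)
  case (Cons x w)
  then show ?case by (cases w) (auto simp: successively_Cons)
qed simp

lemma foldr_cancel_cons_inverse: "foldr cancel_cons (rev (map inv_letter w)) w = []"
  by (induction w) simp_all

typedef 'a free_group = "{w :: ('a \<times> bool) list. reduced w}"
  morphisms word_of Abs_free_group
  by (rule exI[of _ "[]"]) simp

setup_lifting type_definition_free_group

instantiation free_group :: (type) "{monoid_mult, inverse}"
begin

lift_definition one_free_group :: "'a free_group" is "[]" by simp

lift_definition times_free_group :: "'a free_group \<Rightarrow> 'a free_group \<Rightarrow> 'a free_group"
  is "foldr cancel_cons" by (rule reduced_foldr_cancel_cons)

lift_definition inverse_free_group :: "'a free_group \<Rightarrow> 'a free_group"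
  is "\<lambda>w. rev (map inv_letter w)" by (rule reduced_inverse)

definition divide_free_group :: "'a free_group \<Rightarrow> 'a free_group \<Rightarrow> 'a free_group" where
  "divide_free_group s t = s * inverse t"

instance
  by standard (transfer; simp add: foldr_cancel_cons_assoc foldr_cancel_cons_Nil)+

end

lemma free_group_left_inverse: "inverse s * s = (1 :: 'a free_group)"
  by transfer (rule foldr_cancel_cons_inverse)

definition wlen :: "'a free_group \<Rightarrow> nat" where
  "wlen s = length (word_of s)"

definition word_ball :: "nat \<Rightarrow> 'a free_group set" where
  "word_ball n = {s. wlen s \<le> n}"

lift_definition first_letter :: "'a free_group \<Rightarrow> 'a free_group" is "take 1"
  by (metis append_take_drop_id successively_append_iff)

lift_definition common_beginning :: "'a free_group \<Rightarrow> 'a free_group \<Rightarrow> 'a free_group"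
  is longest_common_prefix
  by (metis longest_common_prefix_prefix1 prefix_def successively_append_iff)


section \<open>Lexicographic orders and the graphs they induce\<close>

definition lexicographic :: "('a free_group \<Rightarrow> 'a free_group \<Rightarrow> bool) \<Rightarrow> bool" where
  "lexicographic le \<longleftrightarrow>
     linear_order {(s, t). le s t} \<and>
     (\<forall>s t. wlen s < wlen t \<longrightarrow> le s t) \<and>
     (\<forall>s t. wlen s = wlen t \<and> s \<noteq> t \<and>
        (let c = common_beginning s t
         in le (first_letter (inverse c * s)) (first_letter (inverse c * t))) \<longrightarrow> le s t)"

definition hat :: "'a free_group \<Rightarrow> 'a free_group set" where
  "hat s = {s, inverse s}"

definition least_rep ::
  "('a free_group \<Rightarrow> 'a free_group \<Rightarrow> bool) \<Rightarrow> 'a free_group set \<Rightarrow> 'a free_group" where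
  "least_rep le \<mu> = (THE s. s \<in> \<mu> \<and> (\<forall>t\<in>\<mu>. le s t))"

definition hat_le ::
  "('a free_group \<Rightarrow> 'a free_group \<Rightarrow> bool) \<Rightarrow> 'a free_group set \<Rightarrow> 'a free_group set \<Rightarrow> bool" where
  "hat_le le \<mu> \<nu> \<longleftrightarrow> le (least_rep le \<mu>) (least_rep le \<nu>)"

definition hat_less ::
  "('a free_group \<Rightarrow> 'a free_group \<Rightarrow> bool) \<Rightarrow> 'a free_group set \<Rightarrow> 'a free_group set \<Rightarrow> bool" where
  "hat_less le \<mu> \<nu> \<longleftrightarrow> hat_le le \<mu> \<nu> \<and> \<mu> \<noteq> \<nu>"

definition last_class ::
  "('a free_group \<Rightarrow> 'a free_group \<Rightarrow> bool) \<Rightarrow> nat \<Rightarrow> 'a free_group set" where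
  "last_class le n = (THE \<nu>. \<nu> \<in> hat ` {s. wlen s = n} \<and>
     (\<forall>\<nu>'\<in>hat ` {s. wlen s = n}. hat_le le \<nu>' \<nu>))"

definition graph_adj ::
  "('a free_group \<Rightarrow> 'a free_group \<Rightarrow> bool) \<Rightarrow> 'a free_group set \<Rightarrow>
   'a free_group \<Rightarrow> 'a free_group \<Rightarrow> bool" where
  "graph_adj le \<mu> s t \<longleftrightarrow> s \<noteq> t \<and> hat_le le (hat (inverse s * t)) \<mu>"

definition is_clique :: "('v \<Rightarrow> 'v \<Rightarrow> bool) \<Rightarrow> 'v set \<Rightarrow> bool" where
  "is_clique adj C \<longleftrightarrow> (\<forall>s\<in>C. \<forall>t\<in>C. s \<noteq> t \<longrightarrow> adj s t)"

definition is_maximal_clique :: "('v \<Rightarrow> 'v \<Rightarrow> bool) \<Rightarrow> 'v set \<Rightarrow> bool" where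
  "is_maximal_clique adj C \<longleftrightarrow> is_clique adj C \<and> (\<forall>C'. is_clique adj C' \<and> C \<subseteq> C' \<longrightarrow> C' = C)"


section \<open>Positive definite functions and realizations\<close>

definition psd_opmatrix :: "'i set \<Rightarrow> ('i \<Rightarrow> 'i \<Rightarrow> 'h::chilbert_space \<Rightarrow> 'h) \<Rightarrow> bool" where
  "psd_opmatrix I A \<longleftrightarrow>
     (\<forall>h. (\<Sum>i\<in>I. \<Sum>j\<in>I. cinner (A i j (h j)) (h i)) \<in> \<real>\<^sub>\<ge>\<^sub>0)"

text \<open>A function on \<open>\<Sigma>\<close> is represented by a function on the whole group; only its values on
  \<open>\<Sigma>\<close> matter. The points \<open>s i\<close> need not be distinct.\<close>

definition positive_definite ::
  "'a free_group set \<Rightarrow> ('a free_group \<Rightarrow> 'h::chilbert_space \<Rightarrow> 'h) \<Rightarrow> bool" where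
  "positive_definite \<Sigma> \<phi> \<longleftrightarrow>
     (\<forall>s\<in>\<Sigma>. bounded_clinear (\<phi> s)) \<and>
     (\<forall>(k::nat) s. (\<forall>i<k. \<forall>j<k. inverse (s i) * s j \<in> \<Sigma>) \<longrightarrow>
        psd_opmatrix {..<k} (\<lambda>i j. \<phi> (inverse (s i) * s j)))"

definition pd_extension ::
  "nat \<Rightarrow> ('a free_group \<Rightarrow> 'h::chilbert_space \<Rightarrow> 'h) \<Rightarrow> ('a free_group \<Rightarrow> 'h \<Rightarrow> 'h) \<Rightarrow> bool" where
  "pd_extension n \<phi> \<Phi> \<longleftrightarrow> positive_definite UNIV \<Phi> \<and> (\<forall>s\<in>word_ball n. \<Phi> s = \<phi> s)"

text \<open>The operators \<open>\<omega> i\<close> realize the matrix \<open>A\<close>, that is \<open>A i j = (\<omega> i)\<^sup>* \<omega> j\<close>, inside an ambient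
  Hilbert space \<open>'k\<close>. The realization space of a submatrix with index set \<open>J\<close> is the closed
  subspace \<open>realization_space \<omega> J\<close> of \<open>'k\<close>; the ambient space may be larger, which makes it possible to
  realize matrices of different sizes in the same type.\<close>

definition realizes ::
  "'i set \<Rightarrow> ('i \<Rightarrow> 'i \<Rightarrow> 'h::chilbert_space \<Rightarrow> 'h) \<Rightarrow> ('i \<Rightarrow> 'h \<Rightarrow> 'k::chilbert_space) \<Rightarrow> bool" where
  "realizes I A \<omega> \<longleftrightarrow>
     (\<forall>i\<in>I. bounded_clinear (\<omega> i)) \<and>
     (\<forall>i\<in>I. \<forall>j\<in>I. \<forall>h h'. cinner (A i j h) h' = cinner (\<omega> j h) (\<omega> i h'))"

definition realization_space :: "('i \<Rightarrow> 'h::chilbert_space \<Rightarrow> 'k::chilbert_space) \<Rightarrow> 'i set \<Rightarrow> 'k set" where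
  "realization_space \<omega> J = closed_cspan (\<Union>i\<in>J. range (\<omega> i))"


section \<open>Central extensions\<close>

text \<open>Below \<open>C\<close> is a clique containing \<open>1\<close> and \<open>s\<close>, and \<open>\<omega>\<close> realizes the matrix of \<open>\<Phi>\<close> over \<open>C\<close>.\<close>

definition D_space ::
  "('a free_group \<Rightarrow> 'h::chilbert_space \<Rightarrow> 'k::chilbert_space) \<Rightarrow> 'a free_group set \<Rightarrow> 'a free_group \<Rightarrow> 'k set"
  where "D_space \<omega> C s = realization_space \<omega> (C - {s}) \<ominus> realization_space \<omega> (C - {1, s})"

definition R_space ::
  "('a free_group \<Rightarrow> 'h::chilbert_space \<Rightarrow> 'k::chilbert_space) \<Rightarrow> 'a free_group set \<Rightarrow> 'a free_group \<Rightarrow> 'k set"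
  where "R_space \<omega> C s = realization_space \<omega> (C - {1}) \<ominus> realization_space \<omega> (C - {1, s})"

text \<open>Only the restriction to \<^term>\<open>D_space \<omega> C s\<close> is relevant.\<close>

definition gamma ::
  "('a free_group \<Rightarrow> 'h::chilbert_space \<Rightarrow> 'k::chilbert_space) \<Rightarrow> 'a free_group set \<Rightarrow> 'a free_group \<Rightarrow> 'k \<Rightarrow> 'k"
  where "gamma \<omega> C s = oproj (R_space \<omega> C s)"

text \<open>For lexicographic \<open>le\<close> there is exactly one maximal clique of the graph of \<open>\<mu>\<close> containing \<open>1\<close>
  and \<open>least_rep le \<mu>\<close>, and it is finite, so the quantifier over \<open>C\<close> just names it. Realizations are unique up to unitary equivalence, so it
  does not matter which one is used; the type argument supplies the space in which they are taken
  and is always universally quantified where this predicate is used.\<close>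

definition is_central_extension ::
  "'k::chilbert_space itself \<Rightarrow> ('a free_group \<Rightarrow> 'a free_group \<Rightarrow> bool) \<Rightarrow> nat \<Rightarrow>
   ('a free_group \<Rightarrow> 'h::chilbert_space \<Rightarrow> 'h) \<Rightarrow> ('a free_group \<Rightarrow> 'h \<Rightarrow> 'h) \<Rightarrow> bool" where
  "is_central_extension _ le n \<phi> \<Phi> \<longleftrightarrow>
     pd_extension n \<phi> \<Phi> \<and>
     (\<forall>\<mu>\<in>range hat. hat_less le (last_class le n) \<mu> \<longrightarrow>
       (\<forall>C. is_maximal_clique (graph_adj le \<mu>) C \<and> 1 \<in> C \<and> least_rep le \<mu> \<in> C \<longrightarrow>
         (\<exists>\<omega> :: 'a free_group \<Rightarrow> 'h \<Rightarrow> 'k.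
            realizes C (\<lambda>s t. \<Phi> (inverse s * t)) \<omega> \<and>
            (\<forall>d\<in>D_space \<omega> C (least_rep le \<mu>). gamma \<omega> C (least_rep le \<mu>) d = 0))))"


section \<open>Maximal orthogonality\<close>

definition minimal_naimark_dilation ::
  "('a free_group \<Rightarrow> 'h::chilbert_space \<Rightarrow> 'h) \<Rightarrow> ('a free_group \<Rightarrow> 'k \<Rightarrow> 'k::chilbert_space) \<Rightarrow>
   ('h \<Rightarrow> 'k) \<Rightarrow> bool" where
  "minimal_naimark_dilation \<Phi> \<pi> V \<longleftrightarrow>
     (\<forall>s. unitary (\<pi> s)) \<and> \<pi> 1 = id \<and> (\<forall>s t. \<pi> (s * t) = \<pi> s \<circ> \<pi> t) \<and>
     bounded_clinear V \<and>
     (\<forall>s h h'. cinner (\<Phi> s h) h' = cinner (\<pi> s (V h)) (V h')) \<and>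
     closed_cspan (\<Union>s. range (\<lambda>h. \<pi> s (V h))) = UNIV"

definition dilation_space ::
  "('a free_group \<Rightarrow> 'k \<Rightarrow> 'k::chilbert_space) \<Rightarrow> ('h::chilbert_space \<Rightarrow> 'k) \<Rightarrow> 'a free_group set \<Rightarrow> 'k set"
  where "dilation_space \<pi> V \<Sigma> = closed_cspan (\<Union>\<sigma>\<in>\<Sigma>. range (\<lambda>h. \<pi> \<sigma> (V h)))"

text \<open>Maximal \<open>n + 1\<close> orthogonality of the extension \<open>\<Phi>\<close> of \<open>\<phi>\<close> from \<^term>\<open>word_ball n\<close>,
  expressed in the minimal dilation given by \<open>\<pi>\<close> and \<open>V\<close>.\<close>

definition maximal_orthogonal_extension ::
  "nat \<Rightarrow> ('a free_group \<Rightarrow> 'h::chilbert_space \<Rightarrow> 'h) \<Rightarrow> ('a free_group \<Rightarrow> 'h \<Rightarrow> 'h) \<Rightarrow>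
   ('a free_group \<Rightarrow> 'k \<Rightarrow> 'k::chilbert_space) \<Rightarrow> ('h \<Rightarrow> 'k) \<Rightarrow> bool" where
  "maximal_orthogonal_extension n \<phi> \<Phi> \<pi> V \<longleftrightarrow>
     pd_extension n \<phi> \<Phi> \<and> minimal_naimark_dilation \<Phi> \<pi> V \<and>
     (\<forall>s t. wlen (inverse s * t) = n + 1 \<longrightarrow>
       (let \<Sigma> = {r. max (wlen (inverse r * s)) (wlen (inverse r * t)) \<le> n} in
         orth_sets
           (dilation_space \<pi> V (\<Sigma> \<union> {s}) \<ominus> dilation_space \<pi> V \<Sigma>)
           (dilation_space \<pi> V (\<Sigma> \<union> {t}) \<ominus> dilation_space \<pi> V \<Sigma>)))"

end

theory Submission
  imports Defs
begin

text \<open>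
  Let \<open>d(s, t)\<close> denote the length of \<open>s\<^sup>-\<^sup>1 t\<close>, and think of an extension \<open>\<Phi>\<close> as a family of operators
  \<open>\<omega> s\<close> into a Hilbert space with \<open>(\<omega> s)\<^sup>* \<omega> t = \<Phi> (s\<^sup>-\<^sup>1 t)\<close>. The parameter \<open>\<gamma>\<^sub>\<mu>\<close> vanishes if and only if, after
  subtraction of the projections onto the span of the rest of the clique \<open>C\<^sub>\<mu>\<close>, the ranges of \<open>\<omega> 1\<close> and
  \<open>\<omega> s\<^sub>\<mu>\<close> are orthogonal: they are orthogonal given \<open>C\<^sub>\<mu> - {1, s\<^sub>\<mu>}\<close>. This conditioning set depends on the order.

  The theorem holds because it can be replaced by one that does not. For \<open>d(s, t) = N + 1\<close> let the lens
  of \<open>s\<close> and \<open>t\<close> be the set of all \<open>r\<close> at distance at most \<open>N\<close> from both. Then \<open>\<Phi>\<close> is central if and only if,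
  for all \<open>N \<ge> n\<close> and all such pairs, \<open>s\<close> and \<open>t\<close> are orthogonal given their lens
  (\<open>central_extension_iff_lens_orthogonal\<close>). The order has disappeared from this criterion, and for
  \<open>N = n\<close> it is maximal \<open>n + 1\<close> orthogonality. Moreover it determines \<open>\<Phi>\<close> on words of length \<open>N + 1\<close> by its
  values on shorter words, because all distances other than \<open>d(s, t)\<close> in the lens with \<open>s\<close> and \<open>t\<close> are at
  most \<open>N\<close> (\<open>lens_orthogonal_unique\<close>).

  The replacement rests on the Cayley graph being a tree. In the graph of the class of
  \<open>s\<^sup>-\<^sup>1 t\<close>, a maximal clique that contains \<open>s\<close> and
  \<open>t\<close> lies between two concentric balls about the midpoint of \<open>s\<close> and
  \<open>t\<close>, the smaller of which is the lens. The points in between are distributed over the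
  branches of the tree at the midpoint, and two of them have distance \<open>N + 1\<close> if and
  only if their branches differ (\<open>wdist_lens_trans\<close>). If the other pairs at distance
  \<open>N + 1\<close> are orthogonal given the lens, then the branches do not interact modulo the
  lens, and conditioning on more points of the clique has no effect on \<open>s\<close> and
  \<open>t\<close> (\<open>cond_orth_enlarge\<close>, \<open>fam_orth_clique_iff\<close>). To deduce
  lens orthogonality from centrality, the pairs are treated in the order of their classes. This is
  possible because a class occurs only once among the pairs with a given midpoint: a translation
  fixing the midpoint permutes a finite ball, and free groups are torsion-free
  (\<open>lens_pair_unique\<close>).

  Realizations are taken in various Hilbert spaces. Orthogonality given a set is a property of Gram
  matrices (\<open>cinner_oproj_transfer\<close>), so it can be carried from one space to another.
\<close>

section \<open>Projections in complex Hilbert spaces\<close>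

lemma cinner_add_right: "cinner x (y + z) = cinner x y + cinner x z"
  by (metis cinner_add_left cinner_commute complex_cnj_add)

lemma cinner_scaleC_right: "cinner x (c *\<^sub>C y) = cnj c * cinner x y"
  by (metis cinner_commute cinner_scaleC_left complex_cnj_mult)

lemma cinner_zero_left [simp]: "cinner 0 x = 0"
  using cinner_add_left[of 0 0 x] by simp

lemma cinner_zero_right [simp]: "cinner x 0 = 0"
  using cinner_add_right[of x 0 0] by simp

lemma cinner_diff_left: "cinner (x - y) z = cinner x z - cinner y z"
  using cinner_add_left[of "x - y" y z] by simp

lemma cinner_diff_right: "cinner x (y - z) = cinner x y - cinner x z"
  using cinner_add_right[of x "y - z" z] by simp

lemma cinner_sum_left: "cinner (sum f A) y = (\<Sum>i\<in>A. cinner (f i) y)"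
  by (induction A rule: infinite_finite_induct) (simp_all add: cinner_add_left)

lemma cinner_sum_right: "cinner x (sum f A) = (\<Sum>i\<in>A. cinner x (f i))"
  by (induction A rule: infinite_finite_induct) (simp_all add: cinner_add_right)

lemma cinner_zero_commute: "cinner x y = 0 \<longleftrightarrow> cinner y x = 0"
  by (metis cinner_commute complex_cnj_zero)

lemma cinner_self: "cinner x x = of_real ((norm x)\<^sup>2)"
proof -
  have "Im (cinner x x) = - Im (cinner x x)"
    by (metis cinner_commute cnj.simps(2))
  then show ?thesis
    by (simp add: complex_eq_iff Re_cinner power2_norm_eq_inner)
qed

lemma cinner_self_eq_zero: "cinner x x = 0 \<longleftrightarrow> x = 0"
  by (simp add: cinner_self)

lemma norm_scaleC: "norm (c *\<^sub>C x) = cmod c * norm x"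
proof -
  have "complex_of_real ((norm (c *\<^sub>C x))\<^sup>2) = (c * cnj c) * cinner x x"
    unfolding cinner_self[symmetric] by (simp add: cinner_scaleC_left cinner_scaleC_right)
  also have "\<dots> = of_real ((cmod c * norm x)\<^sup>2)"
    by (simp add: cinner_self complex_norm_square[symmetric] power_mult_distrib)
  finally show ?thesis
    by (simp only: of_real_eq_iff) (simp add: power2_eq_iff_nonneg)
qed

lemma cmod_cinner_le: "cmod (cinner x y) \<le> norm x * norm y"
proof (cases "cinner x y = 0")
  case False
  \<comment> \<open>The phase \<open>c\<close> makes the inner product real, so that the real Cauchy-Schwarz inequality applies.\<close>
  define c where "c = cnj (cinner x y) / of_real (cmod (cinner x y))"
  have "c * cinner x y = of_real (cmod (cinner x y))"
    using False by (simp add: c_def field_simps complex_norm_square[symmetric] power2_eq_square)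
  then have "cmod (cinner x y) = Re (cinner (c *\<^sub>C x) y)"
    by (simp add: cinner_scaleC_left)
  also have "\<dots> \<le> norm (c *\<^sub>C x) * norm y"
    by (simp add: Re_cinner norm_cauchy_schwarz)
  also have "norm (c *\<^sub>C x) = norm x"
    using False by (simp add: norm_scaleC c_def norm_divide)
  finally show ?thesis .
qed simp

lemma cinner_eq_zero_iff: "cinner x y = 0 \<longleftrightarrow> x \<bullet> y = 0 \<and> (\<i> *\<^sub>C x) \<bullet> y = 0"
  by (simp add: complex_eq_iff Re_cinner[symmetric] cinner_scaleC_left)

lemma closed_orth: "closed {y. cinner x y = 0}"
  unfolding cinner_eq_zero_iff by (intro closed_Collect_conj closed_Collect_eq continuous_intros)

lemma csubspace_orth: "cspace.subspace {y. cinner x y = 0}"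
  by (auto simp: cspace.subspace_def cinner_add_right cinner_scaleC_right)

lemma cspan_subset_closed_cspan: "cspace.span Y \<subseteq> closed_cspan Y"
  unfolding closed_cspan_def by (rule closure_subset)

lemma closed_cspan_base: "y \<in> Y \<Longrightarrow> y \<in> closed_cspan Y"
  using cspan_subset_closed_cspan cspace.span_base by blast

lemma closed_cspan_mono: "X \<subseteq> Y \<Longrightarrow> closed_cspan X \<subseteq> closed_cspan Y"
  unfolding closed_cspan_def by (intro closure_mono cspace.span_mono)

lemma closed_closed_cspan: "closed (closed_cspan Y)"
  by (simp add: closed_cspan_def)

lemma csubspace_closed_cspan: "cspace.subspace (closed_cspan Y)"
proof -
  let ?S = "cspace.span Y"
  have scale: "bounded_linear (\<lambda>x::'a. c *\<^sub>C x)" for c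
    by (rule bounded_linear_intro[where K = "cmod c"])
      (simp_all add: scaleC_add_right norm_scaleC scaleC_of_real[symmetric] scaleC_scaleC mult.commute)
  show ?thesis
    unfolding cspace.subspace_def closed_cspan_def
  proof (intro conjI ballI allI)
    show "0 \<in> closure ?S"
      using cspace.span_zero closure_subset by blast
    fix x y assume "x \<in> closure ?S" "y \<in> closure ?S"
    then obtain f g where "\<And>n. f n \<in> ?S" "f \<longlonglongrightarrow> x" "\<And>n. g n \<in> ?S" "g \<longlonglongrightarrow> y"
      by (metis closure_sequential)
    then show "x + y \<in> closure ?S"
      unfolding closure_sequential by (intro exI[of _ "\<lambda>n. f n + g n"]) (simp add: cspace.span_add tendsto_add)
  next
    fix c x assume "x \<in> closure ?S"
    then obtain f where "\<And>n. f n \<in> ?S" "f \<longlonglongrightarrow> x"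
      by (metis closure_sequential)
    then show "c *\<^sub>C x \<in> closure ?S"
      unfolding closure_sequential
      by (intro exI[of _ "\<lambda>n. c *\<^sub>C f n"]) (simp add: cspace.span_scale bounded_linear.tendsto[OF scale])
  qed
qed

lemma closed_cspan_minimal:
  "Y \<subseteq> S \<Longrightarrow> closed S \<Longrightarrow> cspace.subspace S \<Longrightarrow> closed_cspan Y \<subseteq> S"
  unfolding closed_cspan_def by (intro closure_minimal cspace.span_minimal)

lemma cinner_closed_cspan:
  assumes "\<And>y. y \<in> Y \<Longrightarrow> cinner x y = 0" and "z \<in> closed_cspan Y"
  shows "cinner x z = 0"
  using closed_cspan_minimal[OF _ closed_orth csubspace_orth, of Y x] assms by blast

text \<open>A minimizing sequence is Cauchy because the midpoint of two of its members stays in \<open>S\<close>, so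
  that the parallelogram identity bounds their distance.\<close>
lemma nearest_point_exists:
  fixes x :: "'k::chilbert_space"
  assumes "closed S" and sub: "cspace.subspace S"
  obtains y where "y \<in> S" and "\<And>z. z \<in> S \<Longrightarrow> norm (x - y) \<le> norm (x - z)"
proof -
  define d where "d = Inf ((\<lambda>z. (norm (x - z))\<^sup>2) ` S)"
  have S0: "0 \<in> S" using sub by (simp add: cspace.subspace_def)
  have bdd: "bdd_below ((\<lambda>z. (norm (x - z))\<^sup>2) ` S)"
    by (rule bdd_belowI[of _ 0]) auto
  have d: "d \<le> (norm (x - z))\<^sup>2" if "z \<in> S" for z
    unfolding d_def using bdd that by (rule cINF_lower)
  have "\<exists>z\<in>S. (norm (x - z))\<^sup>2 < d + 1 / real (Suc k)" for k
    using cInf_lessD[of "(\<lambda>z. (norm (x - z))\<^sup>2) ` S" "d + 1 / real (Suc k)"] S0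
    unfolding d_def by auto
  then obtain y where yS: "\<And>k. y k \<in> S" and y: "\<And>k. (norm (x - y k))\<^sup>2 < d + 1 / real (Suc k)"
    by metis
  have mid: "(1/2) *\<^sub>R (y j + y k) \<in> S" for j k
    using sub yS unfolding scaleC_of_real[symmetric] by (simp add: cspace.subspace_add cspace.subspace_scale)
  have diff: "(norm (y j - y k))\<^sup>2 \<le> 4 / real (Suc m)" if "m \<le> j" "m \<le> k" for j k m
  proof -
    have "(norm (y j - y k))\<^sup>2 =
        2 * (norm (x - y j))\<^sup>2 + 2 * (norm (x - y k))\<^sup>2 - 4 * (norm (x - (1/2) *\<^sub>R (y j + y k)))\<^sup>2"
      by (simp add: power2_norm_eq_inner algebra_simps inner_commute)
    also have "\<dots> \<le> 2 * (d + 1 / real (Suc j)) + 2 * (d + 1 / real (Suc k)) - 4 * d"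
      using y[of j, THEN less_imp_le] y[of k, THEN less_imp_le] d[OF mid[of j k]]
      by (intro diff_mono add_mono mult_left_mono) simp_all
    also have "\<dots> = 2 / real (Suc j) + 2 / real (Suc k)"
      by simp
    also have "\<dots> \<le> 2 / real (Suc m) + 2 / real (Suc m)"
      using that by (intro add_mono divide_left_mono) auto
    finally show ?thesis by simp
  qed
  have "Cauchy y"
  proof (rule metric_CauchyI)
    fix e :: real assume "0 < e"
    then obtain m where m: "4 / e\<^sup>2 < real (Suc m)"
      using reals_Archimedean2[of "4 / e\<^sup>2"] by (metis less_SucI of_nat_less_iff order_less_trans lessI)
    have "dist (y j) (y k) < e" if "m \<le> j" "m \<le> k" for j k
    proof -
      have "4 / real (Suc m) < e\<^sup>2"
        using m \<open>0 < e\<close> by (simp add: field_simps)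
      then have "(norm (y j - y k))\<^sup>2 < e\<^sup>2"
        using diff[OF that] by linarith
      then show ?thesis
        using \<open>0 < e\<close> by (simp add: dist_norm power_less_imp_less_base)
    qed
    then show "\<exists>M. \<forall>j\<ge>M. \<forall>k\<ge>M. dist (y j) (y k) < e" by blast
  qed
  then obtain l where l: "y \<longlonglongrightarrow> l"
    using Cauchy_convergent convergent_def by blast
  have "l \<in> S"
    using \<open>closed S\<close> yS l by (metis closed_sequentially)
  moreover have "(norm (x - l))\<^sup>2 \<le> d"
  proof (rule LIMSEQ_le)
    show "(\<lambda>k. (norm (x - y k))\<^sup>2) \<longlonglongrightarrow> (norm (x - l))\<^sup>2"
      by (intro tendsto_intros l)
    show "(\<lambda>k. d + 1 / real (Suc k)) \<longlonglongrightarrow> d"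
      using tendsto_add[OF tendsto_const LIMSEQ_Suc[OF lim_1_over_n]] by simp
    show "\<exists>N. \<forall>k\<ge>N. (norm (x - y k))\<^sup>2 \<le> d + 1 / real (Suc k)"
      using y less_imp_le by blast
  qed
  ultimately show ?thesis
    using that d by (meson norm_ge_zero order_trans power2_le_imp_le)
qed

lemma orthogonal_projection_exists:
  fixes x :: "'k::chilbert_space"
  assumes "closed S" and sub: "cspace.subspace S"
  obtains y where "y \<in> S" and "\<And>z. z \<in> S \<Longrightarrow> cinner (x - y) z = 0"
proof -
  obtain y where y: "y \<in> S" and min: "\<And>z. z \<in> S \<Longrightarrow> norm (x - y) \<le> norm (x - z)"
    using nearest_point_exists[OF assms] by blast
  have real_orth: "(x - y) \<bullet> z = 0" if z: "z \<in> S" for z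
  proof (cases "z = 0")
    case False
    \<comment> \<open>\<open>y + t *\<^sub>R z\<close> is the best approximation of \<open>x\<close> on the line through \<open>y\<close> in direction \<open>z\<close>.\<close>
    define t where "t = ((x - y) \<bullet> z) / (z \<bullet> z)"
    have "y + t *\<^sub>R z \<in> S"
      unfolding scaleC_of_real[symmetric] using sub y z
      by (intro cspace.subspace_add cspace.subspace_scale)
    then have "(norm (x - y))\<^sup>2 \<le> (norm (x - (y + t *\<^sub>R z)))\<^sup>2"
      by (intro power_mono min) auto
    also have "\<dots> = (norm (x - y))\<^sup>2 - 2 * t * ((x - y) \<bullet> z) + t\<^sup>2 * (z \<bullet> z)"
      unfolding power2_norm_eq_inner
      by (simp add: inner_diff inner_add power2_eq_square algebra_simps inner_commute)
    also have "\<dots> = (norm (x - y))\<^sup>2 - ((x - y) \<bullet> z)\<^sup>2 / (z \<bullet> z)"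
      using False by (simp add: t_def field_simps power2_eq_square)
    finally have "((x - y) \<bullet> z)\<^sup>2 / (z \<bullet> z) \<le> 0" by simp
    then show ?thesis
      using False by (metis divide_le_0_iff inner_gt_zero_iff not_le power2_less_eq_zero_iff)
  qed simp
  have "cinner (x - y) z = 0" if "z \<in> S" for z
  proof (rule complex_eqI)
    \<comment> \<open>The real inner product with \<open>\<i> z\<close> is the imaginary part of the complex one with \<open>z\<close>.\<close>
    have "\<i> *\<^sub>C z \<in> S" using sub that by (rule cspace.subspace_scale)
    then show "Im (cinner (x - y) z) = Im 0"
      using real_orth[of "\<i> *\<^sub>C z"] by (simp add: Re_cinner[symmetric] cinner_scaleC_right)
  qed (simp add: Re_cinner real_orth that)
  then show ?thesis using that y by blast
qed

lemma oproj_eqI: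
  assumes "cspace.subspace S" and "y \<in> S" and "\<And>z. z \<in> S \<Longrightarrow> cinner (x - y) z = 0"
  shows "oproj S x = y"
  unfolding oproj_def
proof (rule the_equality)
  fix y' assume y': "y' \<in> S \<and> (\<forall>z\<in>S. cinner (x - y') z = 0)"
  have "y - y' \<in> S" using assms y' by (simp add: cspace.subspace_diff)
  then have "cinner (x - y') (y - y') - cinner (x - y) (y - y') = 0"
    using assms y' by simp
  then have "cinner (y - y') (y - y') = 0"
    by (simp add: cinner_diff_left)
  then show "y' = y" by (simp add: cinner_self_eq_zero)
qed (use assms in blast)

lemma
  assumes "closed S" and "cspace.subspace S"
  shows oproj_in: "oproj S x \<in> S"
    and oproj_orth: "z \<in> S \<Longrightarrow> cinner (x - oproj S x) z = 0"
  using orthogonal_projection_exists[OF assms] oproj_eqI[OF assms(2)] by (metis, metis)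

lemmas oproj_cspan_in = oproj_in[OF closed_closed_cspan csubspace_closed_cspan]
lemmas oproj_cspan_orth = oproj_orth[OF closed_closed_cspan csubspace_closed_cspan]

lemma closed_orth_diff: "closed M \<Longrightarrow> closed (M \<ominus> N)"
proof -
  assume "closed M"
  moreover have "M \<ominus> N = M \<inter> (\<Inter>y\<in>N. {x. cinner y x = 0})"
    by (auto simp: orth_diff_def cinner_zero_commute)
  ultimately show ?thesis by (auto intro!: closed_Int closed_INT closed_orth)
qed

lemma csubspace_orth_diff: "cspace.subspace M \<Longrightarrow> cspace.subspace (M \<ominus> N)"
  by (auto simp: orth_diff_def cspace.subspace_def cinner_add_left cinner_scaleC_left)

section \<open>Conditional orthogonality\<close>

text \<open>For Gaussian families this is conditional independence of \<open>A\<close> and \<open>B\<close> given \<open>N\<close>. It is stated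
  with the orthogonal differences that occur in both the vanishing of a parameter \<open>\<gamma>\<^sub>\<mu>\<close> and maximal
  orthogonality, so that each of them is an instance.\<close>
definition cond_orth :: "'k::chilbert_space set \<Rightarrow> 'k set \<Rightarrow> 'k set \<Rightarrow> bool" where
  "cond_orth N A B \<longleftrightarrow>
     orth_sets (closed_cspan (N \<union> A) \<ominus> closed_cspan N) (closed_cspan (N \<union> B) \<ominus> closed_cspan N)"

lemma cond_orth_commute: "cond_orth N A B \<longleftrightarrow> cond_orth N B A"
  unfolding cond_orth_def orth_sets_def by (metis cinner_zero_commute)

text \<open>Subtracting from \<open>y\<close> its projection onto the span of \<open>N\<close> does not change the inner product with
  \<open>x\<close>, which is orthogonal to \<open>N\<close>.\<close>
lemma cond_orthD:
  assumes "cond_orth N A B"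
    and "x \<in> closed_cspan (N \<union> A)" "\<And>z. z \<in> closed_cspan N \<Longrightarrow> cinner x z = 0"
    and "y \<in> closed_cspan (N \<union> B)"
  shows "cinner x y = 0"
proof -
  let ?p = "oproj (closed_cspan N) y"
  have "?p \<in> closed_cspan N" by (rule oproj_cspan_in)
  moreover from this have "?p \<in> closed_cspan (N \<union> B)"
    using closed_cspan_mono[of N "N \<union> B"] by blast
  ultimately have "y - ?p \<in> closed_cspan (N \<union> B) \<ominus> closed_cspan N"
    using assms(4) oproj_cspan_orth
    by (auto simp: orth_diff_def intro: cspace.subspace_diff[OF csubspace_closed_cspan])
  then have "cinner x (y - ?p) = 0"
    using assms(1,2,3) unfolding cond_orth_def orth_sets_def orth_diff_def by blast
  then show ?thesis
    using assms(3)[OF \<open>?p \<in> closed_cspan N\<close>] by (simp add: cinner_diff_right)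
qed

text \<open>It suffices to test generators, and the residual \<open>a - P a\<close> only against \<open>b\<close> itself, because it is
  already orthogonal to \<open>P b\<close>. In this form conditional orthogonality distributes over unions.\<close>
lemma cond_orth_iff:
  "cond_orth N A B \<longleftrightarrow> (\<forall>a\<in>A. \<forall>b\<in>B. cinner (oproj (closed_cspan N) a) b = cinner a b)"
proof
  assume orth: "cond_orth N A B"
  show "\<forall>a\<in>A. \<forall>b\<in>B. cinner (oproj (closed_cspan N) a) b = cinner a b"
  proof (intro ballI)
    fix a b assume "a \<in> A" "b \<in> B"
    let ?p = "oproj (closed_cspan N) a"
    have "a \<in> closed_cspan (N \<union> A)" and b: "b \<in> closed_cspan (N \<union> B)"
      using \<open>a \<in> A\<close> \<open>b \<in> B\<close> by (simp_all add: closed_cspan_base)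
    moreover have "?p \<in> closed_cspan (N \<union> A)"
      using oproj_cspan_in closed_cspan_mono[of N "N \<union> A"] by blast
    ultimately have "a - ?p \<in> closed_cspan (N \<union> A)"
      by (intro cspace.subspace_diff[OF csubspace_closed_cspan])
    from cond_orthD[OF orth this oproj_cspan_orth b]
    show "cinner ?p b = cinner a b" by (simp add: cinner_diff_left)
  qed
next
  assume eq: "\<forall>a\<in>A. \<forall>b\<in>B. cinner (oproj (closed_cspan N) a) b = cinner a b"
  let ?P = "oproj (closed_cspan N)"
  have "cinner d e = 0"
    if d: "d \<in> closed_cspan (N \<union> A)" "\<And>z. z \<in> closed_cspan N \<Longrightarrow> cinner d z = 0"
      and e: "e \<in> closed_cspan (N \<union> B)" for d e
  proof (rule cinner_closed_cspan[OF _ e])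
    fix b assume "b \<in> N \<union> B"
    then show "cinner d b = 0"
    proof
      assume "b \<in> N" then show ?thesis
        by (intro d(2) closed_cspan_base)
    next
      assume "b \<in> B"
      have "cinner (b - ?P b) d = 0"
      proof (rule cinner_closed_cspan[OF _ d(1)])
        fix a assume "a \<in> N \<union> A"
        then show "cinner (b - ?P b) a = 0"
        proof
          assume "a \<in> N" then show ?thesis
            by (intro oproj_cspan_orth closed_cspan_base)
        next
          assume "a \<in> A"
          have "cinner a (b - ?P b) = cinner (a - ?P a) b + cinner (?P a) (b - ?P b)
              - cinner (a - ?P a) (?P b)"
            by (simp add: cinner_diff_left cinner_diff_right)
          also have "\<dots> = 0"
            using eq \<open>a \<in> A\<close> \<open>b \<in> B\<close> cinner_zero_commute[of "?P a" "b - ?P b"]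
            by (simp add: cinner_diff_left[of a] oproj_cspan_orth[OF oproj_cspan_in])
          finally show ?thesis by (simp add: cinner_zero_commute)
        qed
      qed
      then have "cinner d (b - ?P b) = 0" by (simp add: cinner_zero_commute)
      then show ?thesis using d(2)[OF oproj_cspan_in] by (simp add: cinner_diff_right)
    qed
  qed
  then show "cond_orth N A B"
    unfolding cond_orth_def orth_sets_def orth_diff_def by blast
qed

lemma cond_orth_Un_left: "cond_orth N (A \<union> A') B \<longleftrightarrow> cond_orth N A B \<and> cond_orth N A' B"
  unfolding cond_orth_iff by blast

lemma cond_orth_UN_left: "cond_orth N (\<Union>i\<in>I. A i) B \<longleftrightarrow> (\<forall>i\<in>I. cond_orth N (A i) B)"
  unfolding cond_orth_iff by blast

lemma cond_orth_UN_right: "cond_orth N A (\<Union>i\<in>I. B i) \<longleftrightarrow> (\<forall>i\<in>I. cond_orth N A (B i))"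
  unfolding cond_orth_iff by blast

text \<open>Modulo \<open>N\<close>, the best approximation of \<open>u\<close> from \<open>X\<close> and \<open>Y\<close> uses \<open>X\<close> only, since \<open>Y\<close> is orthogonal to
  \<open>u\<close> and to \<open>X\<close>. The part that \<open>X\<close> contributes is orthogonal to \<open>V\<close>. So conditioning on \<open>X\<close> and \<open>Y\<close> as
  well changes nothing for the pair \<open>U\<close>, \<open>V\<close>.\<close>
lemma cond_orth_enlarge:
  assumes "cond_orth N X Y" "cond_orth N U Y" "cond_orth N X V"
  shows "cond_orth (N \<union> X \<union> Y) U V \<longleftrightarrow> cond_orth N U V"
proof -
  have "cinner (oproj (closed_cspan (N \<union> X \<union> Y)) u) v = cinner (oproj (closed_cspan N) u) v"
    if "u \<in> U" "v \<in> V" for u v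
  proof -
    let ?p = "oproj (closed_cspan N) u" and ?q = "oproj (closed_cspan (N \<union> X)) u"
    have N: "z \<in> closed_cspan (N \<union> X)" if "z \<in> closed_cspan N" for z
      using that closed_cspan_mono[of N "N \<union> X"] by blast
    have q: "?q \<in> closed_cspan (N \<union> X)" by (rule oproj_cspan_in)
    have "oproj (closed_cspan (N \<union> X \<union> Y)) u = ?q"
    proof (rule oproj_eqI[OF csubspace_closed_cspan])
      show "?q \<in> closed_cspan (N \<union> X \<union> Y)"
        using q closed_cspan_mono[of "N \<union> X" "N \<union> X \<union> Y"] by blast
      have diff: "u - ?q \<in> closed_cspan (N \<union> (U \<union> X))"
      proof (rule cspace.subspace_diff[OF csubspace_closed_cspan])
        show "u \<in> closed_cspan (N \<union> (U \<union> X))"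
          using that(1) by (simp add: closed_cspan_base)
        show "?q \<in> closed_cspan (N \<union> (U \<union> X))"
          using q closed_cspan_mono[of "N \<union> X" "N \<union> (U \<union> X)"] by blast
      qed
      have "cond_orth N (U \<union> X) Y"
        using assms(1,2) by (simp add: cond_orth_Un_left)
      from cond_orthD[OF this diff oproj_cspan_orth[OF N]]
      have Y: "cinner (u - ?q) z = 0" if "z \<in> closed_cspan (N \<union> Y)" for z
        using that by blast
      fix z assume z: "z \<in> closed_cspan (N \<union> X \<union> Y)"
      show "cinner (u - ?q) z = 0"
      proof (rule cinner_closed_cspan[OF _ z])
        fix y assume "y \<in> N \<union> X \<union> Y"
        then consider "y \<in> closed_cspan (N \<union> X)" | "y \<in> closed_cspan (N \<union> Y)"
          by (auto intro: closed_cspan_base)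
        then show "cinner (u - ?q) y = 0"
          by cases (rule oproj_cspan_orth Y, assumption)+
      qed
    qed
    moreover have "cinner (?q - ?p) v = 0"
    proof (rule cond_orthD[OF assms(3)])
      show "?q - ?p \<in> closed_cspan (N \<union> X)"
        using q N[OF oproj_cspan_in] by (rule cspace.subspace_diff[OF csubspace_closed_cspan])
      show "v \<in> closed_cspan (N \<union> V)"
        using that(2) by (simp add: closed_cspan_base)
      fix z assume z: "z \<in> closed_cspan N"
      have "cinner (u - ?p) z - cinner (u - ?q) z = 0"
        using oproj_cspan_orth[OF z] oproj_cspan_orth[OF N[OF z]] by simp
      then show "cinner (?q - ?p) z = 0" by (simp add: cinner_diff_left)
    qed
    ultimately show ?thesis by (simp add: cinner_diff_left)
  qed
  then show ?thesis unfolding cond_orth_iff by simp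
qed

lemma cspan_image_explicit:
  assumes "x \<in> cspace.span (f ` J)"
  obtains T c where "finite T" "T \<subseteq> J" "x = (\<Sum>j\<in>T. c j *\<^sub>C f j)"
proof -
  obtain t r where t: "finite t" "t \<subseteq> f ` J" "x = (\<Sum>a\<in>t. r a *\<^sub>C a)"
    using assms unfolding cspace.span_explicit by blast
  then obtain U where U: "U \<subseteq> J" "inj_on f U" "t = f ` U"
    using t(2) unfolding subset_image_inj by blast
  then show ?thesis
    using t by (intro that[of U "\<lambda>j. r (f j)"]) (auto simp: sum.reindex finite_image_iff)
qed

text \<open>The Gram matrix of a family determines how projections onto its span interact with it, even
  though the families live in different spaces. The inner product of \<open>a\<close> with \<open>b\<close> does not occur
  among the hypotheses; this is what makes the lemma usable for reconstructing that entry.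

  A combination \<open>x\<close> that is within \<open>e\<close> of \<open>P a\<close> satisfies \<open>\<bar>\<langle>a - x, y\<rangle>\<bar> \<le> e \<parallel>y\<parallel>\<close> on the span. This is a statement
  about the Gram matrix, hence holds for the corresponding combination \<open>x'\<close>, which is therefore
  within \<open>e\<close> of \<open>P' a'\<close>.\<close>
lemma cinner_oproj_transfer:
  fixes f :: "'j \<Rightarrow> 'k::chilbert_space" and f' :: "'j \<Rightarrow> 'l::chilbert_space"
  assumes gram: "\<And>i j. i \<in> J \<Longrightarrow> j \<in> J \<Longrightarrow> cinner (f i) (f j) = cinner (f' i) (f' j)"
    and a: "\<And>j. j \<in> J \<Longrightarrow> cinner a (f j) = cinner a' (f' j)"
    and b: "\<And>j. j \<in> J \<Longrightarrow> cinner (f j) b = cinner (f' j) b'"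
  shows "cinner (oproj (closed_cspan (f ` J)) a) b = cinner (oproj (closed_cspan (f' ` J)) a') b'"
proof -
  let ?P = "oproj (closed_cspan (f ` J)) a" and ?P' = "oproj (closed_cspan (f' ` J)) a'"
  let ?x = "\<lambda>T c. \<Sum>j\<in>T. c j *\<^sub>C f j" and ?x' = "\<lambda>T c. \<Sum>j\<in>T. c j *\<^sub>C f' j"
  have comb: "cinner (?x T c) (?x S d) = cinner (?x' T c) (?x' S d)"
    "cinner a (?x S d) = cinner a' (?x' S d)" "cinner (?x T c) b = cinner (?x' T c) b'"
    if "T \<subseteq> J" "S \<subseteq> J" for T S c d
    unfolding cinner_sum_left cinner_sum_right cinner_scaleC_left cinner_scaleC_right
    using that by (auto intro!: sum.cong simp: gram a b subset_iff)
  have span': "?x' T c \<in> cspace.span (f' ` J)" "?x T c \<in> cspace.span (f ` J)" if "T \<subseteq> J" for T c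
    by (rule cspace.span_sum, rule cspace.span_scale, rule cspace.span_base, use that in blast)+
  have norm: "norm (?x S d) = norm (?x' S d)" if "S \<subseteq> J" for S d
    using comb(1)[OF that that, of d d] unfolding cinner_self of_real_eq_iff
    by (simp add: power2_eq_iff_nonneg)
  have le: "cmod (cinner ?P b - cinner ?P' b') \<le> e * (norm b + norm b')" if "0 < e" for e
  proof -
    have "?P \<in> closure (cspace.span (f ` J))"
      using oproj_cspan_in[of "f ` J" a] by (simp add: closed_cspan_def)
    then obtain x where "x \<in> cspace.span (f ` J)" "norm (?P - x) < e"
      using \<open>0 < e\<close> unfolding closure_approachable by (metis dist_commute dist_norm)
    moreover from this(1) obtain T c where "finite T" and T: "T \<subseteq> J" and "x = ?x T c"
      by (rule cspan_image_explicit)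
    ultimately have x: "norm (?P - ?x T c) < e" by simp
    let ?z = "?P' - ?x' T c"
    \<comment> \<open>On the span, \<open>a\<close> and its projection have the same inner products, and these are shared by the two families.\<close>
    have est: "\<bar>?z \<bullet> y\<bar> \<le> e * norm y" if in_span: "y \<in> cspace.span (f' ` J)" for y
    proof -
      obtain S d where "finite S" and S: "S \<subseteq> J" and y: "y = ?x' S d"
        using in_span by (rule cspan_image_explicit)
      have "cinner (a' - ?P') y = 0"
        using in_span cspan_subset_closed_cspan by (intro oproj_cspan_orth) blast
      then have "cinner ?z y = cinner a' y - cinner (?x' T c) y"
        by (simp add: cinner_diff_left)
      also have "\<dots> = cinner a (?x S d) - cinner (?x T c) (?x S d)"
        unfolding y comb[OF T S] ..
      also have "cinner (a - ?P) (?x S d) = 0"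
        using span'(2)[OF S] cspan_subset_closed_cspan by (intro oproj_cspan_orth) blast
      then have "cinner a (?x S d) - cinner (?x T c) (?x S d) = cinner (?P - ?x T c) (?x S d)"
        by (simp add: cinner_diff_left)
      finally have "cmod (cinner ?z y) \<le> norm (?P - ?x T c) * norm (?x S d)"
        by (simp add: cmod_cinner_le)
      also have "\<dots> \<le> e * norm y"
        unfolding y norm[OF S] using x by (intro mult_right_mono) auto
      finally show ?thesis
        using abs_Re_le_cmod[of "cinner ?z y"] by (simp add: Re_cinner)
    qed
    have "closure (cspace.span (f' ` J)) \<subseteq> {y. \<bar>?z \<bullet> y\<bar> \<le> e * norm y}"
      by (intro closure_minimal closed_Collect_le continuous_intros) (use est in blast)
    moreover have "?z \<in> closed_cspan (f' ` J)"
      using span'(1)[OF T] cspan_subset_closed_cspan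
      by (intro cspace.subspace_diff[OF csubspace_closed_cspan] oproj_cspan_in) blast
    ultimately have "norm ?z * norm ?z \<le> e * norm ?z"
      by (auto simp: closed_cspan_def power2_norm_eq_inner[symmetric] power2_eq_square)
    then have z: "norm ?z \<le> e"
      using \<open>0 < e\<close> by (cases "?z = 0") auto
    have "cinner ?P b - cinner ?P' b' = cinner (?P - ?x T c) b - cinner ?z b'"
      using comb(3)[OF T T] by (simp add: cinner_diff_left)
    also have "cmod \<dots> \<le> norm (?P - ?x T c) * norm b + norm ?z * norm b'"
      by (intro order_trans[OF norm_triangle_ineq4] add_mono cmod_cinner_le)
    also have "\<dots> \<le> e * norm b + e * norm b'"
      using x z by (intro add_mono mult_right_mono) auto
    finally show ?thesis by (simp add: distrib_left)
  qed
  have "cmod (cinner ?P b - cinner ?P' b') \<le> 0"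
  proof (rule field_le_epsilon)
    fix e :: real assume "0 < e"
    let ?K = "norm b + norm b' + 1"
    have "0 < ?K" by (simp add: add_nonneg_pos)
    then have "cmod (cinner ?P b - cinner ?P' b') \<le> e / ?K * (norm b + norm b')"
      using \<open>0 < e\<close> by (intro le) simp
    also have "\<dots> \<le> e / ?K * ?K"
      using \<open>0 < e\<close> \<open>0 < ?K\<close> by (intro mult_left_mono) auto
    finally show "cmod (cinner ?P b - cinner ?P' b') \<le> 0 + e"
      using \<open>0 < ?K\<close> by simp
  qed
  then show ?thesis by simp
qed

section \<open>The tree metric of a free group\<close>

interpretation free_group: group "(*)" "1 :: 'a free_group" inverse
  by unfold_locales (simp_all add: free_group_left_inverse)

text \<open>The left invariant word metric: the distance in the Cayley graph, which is a tree.\<close>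
abbreviation wdist :: "'a free_group \<Rightarrow> 'a free_group \<Rightarrow> nat" where
  "wdist s t \<equiv> wlen (inverse s * t)"

lemma wlen_1 [simp]: "wlen 1 = 0"
  by (simp add: wlen_def one_free_group.rep_eq)

lemma wlen_eq_0 [simp]: "wlen s = 0 \<longleftrightarrow> s = 1"
  by (simp add: wlen_def word_of_inject[symmetric] one_free_group.rep_eq)

lemma wlen_inverse [simp]: "wlen (inverse s) = wlen s"
  by (simp add: wlen_def inverse_free_group.rep_eq)

lemma wdist_commute: "wdist s t = wdist t s"
  using wlen_inverse[of "inverse s * t"] by (simp add: free_group.inverse_distrib_swap)

lemma inverse_mult_cancel: "inverse (g * s) * (g * t) = inverse s * (t :: 'a free_group)"
  by (simp add: free_group.inverse_distrib_swap mult.assoc)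
    (simp add: mult.assoc[symmetric])

text \<open>The Gromov product based at the unit; it satisfies an ultrametric inequality because two
  beginnings of the same word are comparable.\<close>
abbreviation overlap :: "'a free_group \<Rightarrow> 'a free_group \<Rightarrow> nat" where
  "overlap s t \<equiv> length (longest_common_prefix (word_of s) (word_of t))"

lemma foldr_cancel_cons_append: "reduced (u @ w) \<Longrightarrow> foldr cancel_cons u w = u @ w"
proof (induction u)
  case (Cons x u)
  then show ?case by (cases "u @ w") (auto simp: successively_Cons)
qed simp

lemma length_cancel_inverse:
  assumes "reduced u" "reduced w"
  shows "length (foldr cancel_cons (rev (map inv_letter u)) w) + 2 * length (longest_common_prefix u w)
    = length u + length w"
  using assms
proof (induction u w rule: longest_common_prefix.induct)
  case (1 x u y w)
  show ?case
  proof (cases "x = y")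
    case True
    then show ?thesis
      using 1 by (auto simp: successively_Cons)
  next
    case False
    have "reduced (rev (map inv_letter (x # u)) @ y # w)"
      using 1(2,3) reduced_inverse[OF 1(2)] False
      by (auto simp: successively_append_iff last_rev hd_map)
    then show ?thesis
      using foldr_cancel_cons_append[of "rev (map inv_letter (x # u))" "y # w"] False by simp
  qed
next
  case ("2_1" w)
  then show ?case by simp
next
  case ("2_2" u)
  then show ?case using foldr_cancel_cons_Nil[OF reduced_inverse, of u] by simp
qed

lemma wdist_overlap: "wdist s t + 2 * overlap s t = wlen s + wlen t"
  using length_cancel_inverse[of "word_of s" "word_of t"] word_of[of s] word_of[of t]
  by (simp add: wlen_def times_free_group.rep_eq inverse_free_group.rep_eq)

lemma overlap_ultrametric: "min (overlap x z) (overlap y z) \<le> overlap x y"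
proof -
  let ?p = "longest_common_prefix (word_of x) (word_of z)"
  let ?q = "longest_common_prefix (word_of y) (word_of z)"
  let ?r = "longest_common_prefix (word_of x) (word_of y)"
  have "prefix ?p ?q \<or> prefix ?q ?p"
    by (rule prefix_same_cases[OF longest_common_prefix_prefix2 longest_common_prefix_prefix2])
  then have "prefix ?p ?r \<or> prefix ?q ?r"
    by (meson longest_common_prefix_max_prefix longest_common_prefix_prefix1 prefix_order.trans)
  then show ?thesis by (auto dest: prefix_length_le)
qed

text \<open>The metric characterization of trees, through which the shape of the Cayley graph enters. After
  translating \<open>w\<close> to the unit it is the ultrametric inequality for overlaps.\<close>
lemma four_point:
  "wdist x y + wdist z w \<le> max (wdist x z + wdist y w) (wdist x w + wdist y z)"
proof -
  define x' y' z' where "x' = inverse w * x" "y' = inverse w * y" "z' = inverse w * z"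
  have "wdist x y = wdist x' y'" "wdist x z = wdist x' z'" "wdist y z = wdist y' z'"
    by (simp_all add: x'_y'_z'_def inverse_mult_cancel)
  moreover have "wdist x w = wlen x'" "wdist y w = wlen y'" "wdist z w = wlen z'"
    by (simp_all add: x'_y'_z'_def wdist_commute[of _ w])
  ultimately show ?thesis
    using wdist_overlap[of x' y'] wdist_overlap[of x' z'] wdist_overlap[of y' z']
      overlap_ultrametric[of x' z' y'] by linarith
qed

text \<open>If \<open>g * g\<close> were not longer than \<open>g\<close>, at least half of the word of \<open>g\<close> would cancel. Its letters
  would then satisfy \<open>w\<^sub>i = inv w\<^bsub>L-1-i\<^esub>\<close> up to the middle, where this contradicts reducedness for
  even length \<open>L\<close> and says that a letter is its own inverse for odd \<open>L\<close>.\<close>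
lemma wlen_square:
  assumes "g \<noteq> 1"
  shows "wlen g < wlen (g * g)"
proof -
  let ?w = "word_of g" and ?v = "word_of (inverse g)"
  define L k where "L = wlen g" and "k = overlap (inverse g) g"
  have pre: "take k ?v = take k ?w" "k \<le> L"
  proof -
    have "prefix (longest_common_prefix ?v ?w) ?v" "prefix (longest_common_prefix ?v ?w) ?w"
      by (simp_all add: longest_common_prefix_prefix1 longest_common_prefix_prefix2)
    then show "take k ?v = take k ?w" "k \<le> L"
      unfolding k_def L_def wlen_def by (metis append_eq_conv_conj prefix_def, metis prefix_length_le)
  qed
  have len: "length ?w = L" "length ?v = L"
    using wlen_inverse[of g] by (simp_all add: L_def wlen_def)
  have sym: "?w ! i = inv_letter (?w ! (L - 1 - i))" if "i < k" for i
  proof -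
    have "?w ! i = take k ?w ! i" using that by simp
    also have "\<dots> = ?v ! i" using that by (simp add: pre(1)[symmetric])
    also have "\<dots> = inv_letter (?w ! (L - 1 - i))"
      using that pre(2) len by (simp add: inverse_free_group.rep_eq rev_nth)
    finally show ?thesis .
  qed
  have "2 * k < L"
  proof (rule ccontr)
    assume "\<not> 2 * k < L"
    moreover have "0 < L" using assms by (metis L_def neq0_conv wlen_eq_0)
    ultimately have L: "0 < L" "L \<le> 2 * k" by simp_all
    show False
    proof (cases "even L")
      case True
      then obtain m where m: "L = 2 * Suc m"
        using L(1) by (metis evenE mult_0_right not0_implies_Suc not_gr_zero)
      then have "?w ! Suc m \<noteq> inv_letter (?w ! m)"
        using word_of[of g] len(1) by (simp add: successively_conv_nth)
      moreover have "L - 1 - m = Suc m" "m < k" using m L(2) by simp_all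
      ultimately show False using sym[of m] by simp
    next
      case False
      then obtain m where "L = 2 * m + 1" by (rule oddE)
      then have "L - 1 - m = m" "m < k" using L(2) by simp_all
      then show False using sym[of m] inv_letter_neq[of "?w ! m"] by simp
    qed
  qed
  then show ?thesis
    using wdist_overlap[of "inverse g" g] by (simp add: k_def L_def)
qed

lemma finite_wlen_le: "finite {s :: 'a::finite free_group. wlen s \<le> N}"
proof (rule finite_imageD)
  have "finite {xs :: ('a \<times> bool) list. set xs \<subseteq> UNIV \<and> length xs \<le> N}"
    by (rule finite_lists_length_le) simp
  then show "finite (word_of ` {s :: 'a free_group. wlen s \<le> N})"
    by (rule finite_subset[rotated]) (auto simp: wlen_def)
  show "inj_on word_of {s :: 'a free_group. wlen s \<le> N}"
    by (simp add: inj_on_def word_of_inject)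
qed

lemma exists_wlen: "\<exists>s :: 'a free_group. wlen s = N"
proof
  let ?w = "replicate N (undefined :: 'a, True)"
  have "reduced ?w"
    by (induction N) (auto simp: successively_Cons inv_letter_def hd_replicate)
  then show "wlen (Abs_free_group ?w) = N"
    by (simp add: wlen_def Abs_free_group_inverse)
qed

text \<open>Free groups have no torsion: by the previous growth property the powers \<open>g ^ 2 ^ k\<close> are distinct,
  but all translates of \<open>b\<close> by them stay in the finite set.\<close>
lemma translation_of_finite_set:
  fixes g :: "'a free_group"
  assumes "finite B" "b \<in> B" and stable: "\<And>x. x \<in> B \<Longrightarrow> g * x \<in> B"
  shows "g = 1"
proof (rule ccontr)
  assume "g \<noteq> 1"
  have mono: "wlen (g ^ 2 ^ k) < wlen (g ^ 2 ^ Suc k)" for k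
  proof -
    have "g ^ 2 ^ k \<noteq> 1"
    proof (induction k)
      case (Suc k)
      then show ?case
        using wlen_square[OF Suc] by (auto simp: mult_2 power_add)
    qed (simp add: \<open>g \<noteq> 1\<close>)
    then show ?thesis
      using wlen_square by (simp add: mult_2 power_add)
  qed
  have "strict_mono (\<lambda>k. wlen (g ^ 2 ^ k))"
    using mono by (rule strict_monoI_Suc)
  then have "inj (\<lambda>k. g ^ 2 ^ k * b)"
    by (intro injI) (metis free_group.right_cancel strict_mono_eq)
  moreover have "g ^ k * b \<in> B" for k
    using assms(2) by (induction k) (simp_all add: stable mult.assoc)
  then have "range (\<lambda>k. g ^ 2 ^ k * b) \<subseteq> B" by blast
  ultimately show False
    using \<open>finite B\<close> by (metis finite_subset finite_imageD infinite_UNIV_nat)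
qed


section \<open>Lenses\<close>

text \<open>If \<open>s\<close> and \<open>t\<close> have distance \<open>N + 1\<close>, then \<open>lens N s t\<close> and \<open>lens (N + 1) s t\<close> are the balls of radius
  \<open>(N - 1) / 2\<close> and \<open>(N + 1) / 2\<close> about the midpoint of the geodesic from \<open>s\<close> to \<open>t\<close>. Describing these balls by
  their common neighbours avoids midpoints, which for odd \<open>N + 1\<close> are not group elements.\<close>
definition lens :: "nat \<Rightarrow> 'a free_group \<Rightarrow> 'a free_group \<Rightarrow> 'a free_group set" where
  "lens k s t = {r. max (wdist r s) (wdist r t) \<le> k}"

lemma mem_lens: "r \<in> lens k s t \<longleftrightarrow> wdist r s \<le> k \<and> wdist r t \<le> k"
  by (simp add: lens_def)

lemma lens_commute: "lens k s t = lens k t s"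
  by (auto simp: mem_lens)

lemma translate_lens: "g * r \<in> lens k (g * s) (g * t) \<longleftrightarrow> r \<in> lens k s t"
  by (simp add: mem_lens inverse_mult_cancel)

lemma translate_lens_image: "(*) g ` lens k s t = lens k (g * s) (g * t)"
proof (intro subset_antisym subsetI)
  fix r assume r: "r \<in> lens k (g * s) (g * t)"
  have "g * (inverse g * r) = r"
    by (simp add: mult.assoc[symmetric])
  then show "r \<in> (*) g ` lens k s t"
    using r translate_lens[of g "inverse g * r" k s t] by (metis imageI)
qed (auto simp: translate_lens)

lemma finite_lens: "finite (lens k s (t :: 'a::finite free_group))"
proof (rule finite_subset)
  show "lens k s t \<subseteq> (\<lambda>r. s * r) ` {r. wlen r \<le> k}"
  proof
    fix r assume "r \<in> lens k s t"
    then have "r = s * (inverse s * r)" "wlen (inverse s * r) \<le> k"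
      by (simp_all add: mult.assoc[symmetric] mem_lens wdist_commute[of s r])
    then show "r \<in> (\<lambda>r. s * r) ` {r. wlen r \<le> k}" by blast
  qed
qed (simp add: finite_wlen_le)

lemma wdist_lens:
  assumes "r \<in> lens i s t" "r' \<in> lens j s t"
  shows "wdist r r' + wdist s t \<le> i + j"
  using four_point[of r r' s t] assms by (auto simp: mem_lens)

lemma lens_subset:
  assumes "wdist s t = M" "u \<in> lens M s t" "v \<in> lens M s t"
  shows "lens k s t \<subseteq> lens k u v"
proof
  fix r assume "r \<in> lens k s t"
  then show "r \<in> lens k u v"
    using wdist_lens[of r k s t _ M] assms by (auto simp: mem_lens)
qed

lemma ends_in_lens: "wdist s t \<le> k \<Longrightarrow> s \<in> lens k s t" "wdist s t \<le> k \<Longrightarrow> t \<in> lens k s t"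
  by (simp_all add: mem_lens wdist_commute)

text \<open>Two pairs at distance \<open>M\<close> in the same ball of radius \<open>M / 2\<close> have the same midpoint.\<close>
lemma lens_eq:
  assumes "wdist s t = M" "wdist u v = M" "u \<in> lens M s t" "v \<in> lens M s t"
  shows "lens k u v = lens k s t"
proof
  show "lens k s t \<subseteq> lens k u v" using assms lens_subset by blast
  have "s \<in> lens M u v" "t \<in> lens M u v"
    using lens_subset[of s t M u v M] assms ends_in_lens[of s t M] by auto
  then show "lens k u v \<subseteq> lens k s t"
    using assms lens_subset by blast
qed

text \<open>Points of the sphere about the midpoint have distance at most \<open>N\<close> exactly if they lie in the same
  branch of the tree at the midpoint. If \<open>u\<close> and \<open>w\<close> were in different branches, then \<open>v\<close>, being close to
  both, would lie in their lens, that is, inside the sphere.\<close>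
lemma wdist_lens_trans:
  assumes "wdist s t = Suc N" and "u \<in> lens (Suc N) s t" "w \<in> lens (Suc N) s t"
    and "v \<notin> lens N s t"
    and "wdist u v \<le> N" "wdist v w \<le> N"
  shows "wdist u w \<le> N"
proof (rule ccontr)
  assume "\<not> wdist u w \<le> N"
  then have uw: "wdist u w = Suc N"
    using wdist_lens[OF assms(2,3)] assms(1) by simp
  have "v \<in> lens N u w"
    using assms(5,6) by (simp add: mem_lens wdist_commute)
  then show False
    using lens_eq[OF assms(1) uw assms(2,3)] assms(4) by simp
qed

text \<open>A translation that moves one such pair to another one fixes the common midpoint and thus maps the
  finite lens to itself, so it is trivial.\<close>
lemma lens_pair_unique:
  fixes u v a b :: "'a::finite free_group"
  assumes M: "wdist u v = M" and a: "a \<in> lens M u v" and b: "b \<in> lens M u v"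
    and "hat (inverse a * b) = hat (inverse u * v)"
  shows "{a, b} = {u, v}"
proof -
  have same: "a = u \<and> b = v"
    if M: "wdist u v = M" and ab: "a \<in> lens M u v" "b \<in> lens M u v"
      and eq: "inverse a * b = inverse u * v" for u v :: "'a free_group"
  proof -
    define g where "g = a * inverse u"
    have a': "a = g * u" and b': "b = g * v"
      using arg_cong[OF eq, of "\<lambda>x. a * x"] by (simp_all add: g_def mult.assoc[symmetric])
      (simp add: g_def mult.assoc)
    have "lens M a b = lens M u v"
      using M eq ab by (intro lens_eq) simp_all
    then have "g * x \<in> lens M u v" if "x \<in> lens M u v" for x
      using that translate_lens[of g x M u v] by (simp add: a' b')
    then have "g = 1"
      by (rule translation_of_finite_set[OF finite_lens ab(1)])
    then show ?thesis by (simp add: a' b')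
  qed
  have "inverse a * b = inverse u * v \<or> inverse a * b = inverse v * u"
    using assms(4) by (auto simp: hat_def doubleton_eq_iff free_group.inverse_distrib_swap)
  then show ?thesis
    using same[OF M a b] same[of v u] assms by (auto simp: lens_commute wdist_commute)
qed

section \<open>Realizations of translation invariant kernels\<close>

text \<open>The vectors whose closed span is the realization space.\<close>
abbreviation ranges :: "('i \<Rightarrow> 'h \<Rightarrow> 'k) \<Rightarrow> 'i set \<Rightarrow> 'k set" where
  "ranges \<omega> X \<equiv> (\<Union>i\<in>X. range (\<omega> i))"

abbreviation fam_orth :: "('i \<Rightarrow> 'h \<Rightarrow> 'k::chilbert_space) \<Rightarrow> 'i set \<Rightarrow> 'i \<Rightarrow> 'i \<Rightarrow> bool" where
  "fam_orth \<omega> X u v \<equiv> cond_orth (ranges \<omega> X) (range (\<omega> u)) (range (\<omega> v))"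

abbreviation toeplitz :: "('a free_group \<Rightarrow> 'h \<Rightarrow> 'h) \<Rightarrow> 'a free_group \<Rightarrow> 'a free_group \<Rightarrow> 'h \<Rightarrow> 'h" where
  "toeplitz \<Phi> \<equiv> \<lambda>s t. \<Phi> (inverse s * t)"

lemma fam_orth_commute: "fam_orth \<omega> X u v \<longleftrightarrow> fam_orth \<omega> X v u"
  by (rule cond_orth_commute)

lemma realizes_mono: "realizes I A \<omega> \<Longrightarrow> J \<subseteq> I \<Longrightarrow> realizes J A \<omega>"
  unfolding realizes_def by blast

lemma realizes_gram:
  "realizes I A \<omega> \<Longrightarrow> i \<in> I \<Longrightarrow> j \<in> I \<Longrightarrow> cinner (\<omega> j h) (\<omega> i h') = cinner (A i j h) h'"
  unfolding realizes_def by simp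

lemma realizes_translate:
  assumes "realizes I (toeplitz \<Phi>) \<omega>" and "\<And>s. s \<in> J \<Longrightarrow> g * s \<in> I"
  shows "realizes J (toeplitz \<Phi>) (\<lambda>s. \<omega> (g * s))"
  unfolding realizes_def
proof (intro conjI ballI allI)
  fix i j h h' assume "i \<in> J" "j \<in> J"
  then show "cinner (\<Phi> (inverse i * j) h) h' = cinner (\<omega> (g * j) h) (\<omega> (g * i) h')"
    using realizes_gram[OF assms(1) assms(2) assms(2), of i j] by (simp add: inverse_mult_cancel)
qed (use assms in \<open>simp add: realizes_def\<close>)

text \<open>The entry \<open>(v, u)\<close> is exempt from the comparison of the kernels, so that it can be recovered from
  the others.\<close>
lemma cinner_oproj_realizations:
  fixes \<omega> :: "'i \<Rightarrow> 'h::chilbert_space \<Rightarrow> 'k::chilbert_space"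
    and \<omega>' :: "'i \<Rightarrow> 'h \<Rightarrow> 'l::chilbert_space"
  assumes real: "realizes (X \<union> {u, v}) A \<omega>" "realizes (X \<union> {u, v}) A' \<omega>'"
    and eq: "\<And>i j. i \<in> X \<union> {v} \<Longrightarrow> j \<in> X \<union> {u} \<Longrightarrow> i \<in> X \<or> j \<in> X \<Longrightarrow> A i j = A' i j"
  shows "cinner (oproj (closed_cspan (ranges \<omega> X)) (\<omega> u h)) (\<omega> v h') =
    cinner (oproj (closed_cspan (ranges \<omega>' X)) (\<omega>' u h)) (\<omega>' v h')"
proof -
  have ranges: "ranges \<eta> X = (\<lambda>(i, h). \<eta> i h) ` (X \<times> UNIV)" for \<eta> :: "'i \<Rightarrow> 'h \<Rightarrow> 'x"
    by auto
  have gram: "cinner (\<omega> j h) (\<omega> i h') = cinner (\<omega>' j h) (\<omega>' i h')"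
    if "i \<in> X \<union> {v}" "j \<in> X \<union> {u}" "i \<in> X \<or> j \<in> X" for i j h h'
    using that realizes_gram[OF real(1), of i j] realizes_gram[OF real(2), of i j] eq[of i j] by auto
  show ?thesis
    unfolding ranges by (rule cinner_oproj_transfer) (auto intro: gram)
qed

lemma fam_orth_transfer:
  assumes "realizes I A \<omega>" "realizes I' A \<omega>'" "X \<union> {u, v} \<subseteq> I" "X \<union> {u, v} \<subseteq> I'"
  shows "fam_orth \<omega> X u v \<longleftrightarrow> fam_orth \<omega>' X u v"
proof -
  have real: "realizes (X \<union> {u, v}) A \<omega>" "realizes (X \<union> {u, v}) A \<omega>'"
    using assms realizes_mono by blast+
  have "cinner (oproj (closed_cspan (ranges \<omega> X)) (\<omega> u h)) (\<omega> v h') =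
      cinner (oproj (closed_cspan (ranges \<omega>' X)) (\<omega>' u h)) (\<omega>' v h')" for h h'
    using real by (rule cinner_oproj_realizations) simp
  moreover have "cinner (\<omega> u h) (\<omega> v h') = cinner (\<omega>' u h) (\<omega>' v h')" for h h'
    using realizes_gram[OF real(1), of v u] realizes_gram[OF real(2), of v u] by simp
  ultimately show ?thesis unfolding cond_orth_iff by simp
qed

text \<open>A projection vanishes on a subspace if and only if that subspace is orthogonal to its range.\<close>
lemma gamma_eq_zero_iff:
  assumes "1 \<in> C" "s \<in> C" "s \<noteq> 1"
  shows "(\<forall>d\<in>D_space \<omega> C s. gamma \<omega> C s d = 0) \<longleftrightarrow> fam_orth \<omega> (C - {1, s}) 1 s"
proof -
  let ?D = "D_space \<omega> C s" and ?R = "R_space \<omega> C s" and ?V = "ranges \<omega> (C - {1, s})"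
  have "ranges \<omega> (C - {s}) = ?V \<union> range (\<omega> 1)" "ranges \<omega> (C - {1}) = ?V \<union> range (\<omega> s)"
    using assms by auto
  then have DR: "?D = closed_cspan (?V \<union> range (\<omega> 1)) \<ominus> closed_cspan ?V"
    "?R = closed_cspan (?V \<union> range (\<omega> s)) \<ominus> closed_cspan ?V"
    unfolding D_space_def R_space_def realization_space_def by simp_all
  have R: "closed ?R" "cspace.subspace ?R"
    unfolding DR by (intro closed_orth_diff csubspace_orth_diff closed_closed_cspan csubspace_closed_cspan)+
  have "oproj ?R d = 0 \<longleftrightarrow> (\<forall>z\<in>?R. cinner d z = 0)" for d
  proof
    assume "oproj ?R d = 0"
    then show "\<forall>z\<in>?R. cinner d z = 0"
      using oproj_orth[OF R, of _ d] by simp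
  next
    assume "\<forall>z\<in>?R. cinner d z = 0"
    then show "oproj ?R d = 0"
      using R(2) by (intro oproj_eqI) (simp_all add: cspace.subspace_0)
  qed
  then show ?thesis
    unfolding gamma_def cond_orth_def orth_sets_def DR[symmetric] by simp
qed

text \<open>The conditioning set \<open>C - {u, v}\<close>, which depends on the order, can be replaced by the lens, which
  does not. The elements of \<open>C\<close> outside the lens lie on the sphere about the midpoint: in the branch of
  \<open>u\<close> (the set \<open>X\<close> in the proof) or in another branch (the set \<open>Y\<close>). Pairs from different branches are at
  distance exactly \<open>N + 1\<close>, so the hypothesis makes \<open>X\<close> and \<open>u\<close> orthogonal to \<open>Y\<close>, and \<open>X\<close> orthogonal to
  \<open>v\<close>, given the lens; \<open>v\<close> itself is not in the branch of \<open>u\<close>.\<close>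
lemma fam_orth_clique_iff:
  assumes uv: "wdist u v = Suc N" and C: "u \<in> C" "v \<in> C" "lens N u v \<subseteq> C" "C \<subseteq> lens (Suc N) u v"
    and cross: "\<And>a b. a \<in> C \<Longrightarrow> b \<in> C \<Longrightarrow> wdist a b = Suc N \<Longrightarrow> {a, b} \<noteq> {u, v} \<Longrightarrow>
      fam_orth \<omega> (lens N u v) a b"
  shows "fam_orth \<omega> (C - {u, v}) u v \<longleftrightarrow> fam_orth \<omega> (lens N u v) u v"
proof -
  let ?Z = "lens N u v"
  define X where "X = {w \<in> C - ?Z - {u, v}. wdist w u \<le> N}"
  define Y where "Y = {w \<in> C - ?Z - {u, v}. wdist w u = Suc N}"
  have le: "wdist a b \<le> Suc N" if "a \<in> C" "b \<in> C" for a b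
    using that C(4) wdist_lens[of a "Suc N" u v b "Suc N"] uv by auto
  have "u \<notin> ?Z" "v \<notin> ?Z"
    using uv by (auto simp: mem_lens wdist_commute[of v u])
  moreover have "w \<in> X \<union> Y" if "w \<in> C - ?Z - {u, v}" for w
    using that le[of w u] C(1) by (auto simp: X_def Y_def)
  ultimately have split: "C - {u, v} = ?Z \<union> X \<union> Y"
    using C(3) by (auto simp: X_def Y_def)
  have xy: "fam_orth \<omega> ?Z x y" if x: "x \<in> X" and y: "y \<in> Y" for x y
  proof (rule cross)
    show xy: "x \<in> C" "y \<in> C" using x y by (simp_all add: X_def Y_def)
    have "\<not> wdist y x \<le> N"
    proof
      assume "wdist y x \<le> N"
      then have "wdist y u \<le> N"
        using uv x y C(1,4) by (intro wdist_lens_trans[of u v N y u x]) (auto simp: X_def Y_def)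
      then show False using y by (simp add: Y_def)
    qed
    then show "wdist x y = Suc N" using le[OF xy] by (simp add: wdist_commute[of y x])
    show "{x, y} \<noteq> {u, v}" using x by (auto simp: X_def)
  qed
  have uy: "fam_orth \<omega> ?Z u y" if y: "y \<in> Y" for y
    using y C(1) by (intro cross) (auto simp: Y_def wdist_commute[of u y] doubleton_eq_iff)
  have xv: "fam_orth \<omega> ?Z x v" if x: "x \<in> X" for x
  proof (rule cross)
    show xC: "x \<in> C" using x by (simp add: X_def)
    show "wdist x v = Suc N"
      using x le[OF xC C(2)] by (auto simp: X_def mem_lens)
    show "{x, v} \<noteq> {u, v}" using x by (auto simp: X_def doubleton_eq_iff)
  qed (rule C(2))
  have "cond_orth (ranges \<omega> ?Z \<union> ranges \<omega> X \<union> ranges \<omega> Y) (range (\<omega> u)) (range (\<omega> v)) \<longleftrightarrow>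
      fam_orth \<omega> ?Z u v"
    by (rule cond_orth_enlarge) (use xy uy xv in \<open>auto simp: cond_orth_UN_left cond_orth_UN_right\<close>)
  then show ?thesis unfolding split UN_Un .
qed


section \<open>Orders that put shorter words first\<close>

lemma hat_inverse: "hat (inverse s) = hat s"
  by (auto simp: hat_def)

lemma hat_wdist_commute: "hat (inverse s * t) = hat (inverse t * s)"
  using hat_inverse[of "inverse s * t"] by (simp add: free_group.inverse_distrib_swap)

text \<open>Lexicographic orders compare lengths first, and so does the linear order that they induce on the
  classes.\<close>
locale length_first_order =
  fixes le :: "'a::finite free_group \<Rightarrow> 'a free_group \<Rightarrow> bool"
  assumes linear: "linear_order {(s, t). le s t}"
    and shorter: "wlen s < wlen t \<Longrightarrow> le s t"
begin

lemma le_refl: "le s s"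
  and le_trans: "le s t \<Longrightarrow> le t r \<Longrightarrow> le s r"
  and le_antisym: "le s t \<Longrightarrow> le t s \<Longrightarrow> s = t"
  and le_total: "le s t \<or> le t s"
  using linear
  unfolding linear_order_on_def partial_order_on_def preorder_on_def refl_on_def trans_on_def
    antisym_on_def total_on_def
  by (auto, metis)

lemma least_rep_hat: "least_rep le (hat s) = (if le s (inverse s) then s else inverse s)"
  unfolding least_rep_def hat_def
  by (rule the_equality)
    (use le_refl le_antisym le_total[of s "inverse s"] in \<open>auto split: if_splits\<close>)

lemma hat_least_rep: "hat (least_rep le (hat s)) = hat s"
  by (simp add: least_rep_hat hat_inverse)

lemma wlen_least_rep: "wlen (least_rep le (hat s)) = wlen s"
  by (simp add: least_rep_hat)

lemma hat_le_refl: "hat_le le \<mu> \<mu>"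
  by (simp add: hat_le_def le_refl)

lemma hat_le_trans: "hat_le le \<mu> \<nu> \<Longrightarrow> hat_le le \<nu> \<rho> \<Longrightarrow> hat_le le \<mu> \<rho>"
  unfolding hat_le_def by (rule le_trans)

lemma hat_le_total: "hat_le le \<mu> \<nu> \<or> hat_le le \<nu> \<mu>"
  by (simp add: hat_le_def le_total)

lemma hat_le_antisym: "hat_le le (hat s) (hat t) \<Longrightarrow> hat_le le (hat t) (hat s) \<Longrightarrow> hat s = hat t"
  unfolding hat_le_def using le_antisym hat_least_rep by metis

lemma hat_le_shorter: "wlen s < wlen t \<Longrightarrow> hat_le le (hat s) (hat t)"
  by (simp add: hat_le_def shorter wlen_least_rep)

lemma wlen_mono: "hat_le le (hat s) (hat t) \<Longrightarrow> wlen s \<le> wlen t"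
  using hat_le_shorter[of t s] hat_le_antisym[of s t] wlen_least_rep
  by (metis linorder_not_less order_less_irrefl)

lemma greatest_class:
  assumes "finite S" "S \<noteq> {}"
  shows "\<exists>\<nu>\<in>S. \<forall>\<nu>'\<in>S. hat_le le \<nu>' \<nu>"
  using assms
proof (induction S rule: finite_ne_induct)
  case (insert \<mu> S)
  then show ?case by (metis hat_le_refl hat_le_total hat_le_trans insert_iff)
qed (simp add: hat_le_refl)

text \<open>Hence the classes that carry a parameter \<open>\<gamma>\<^sub>\<mu>\<close> are those of words longer than \<open>n\<close>, whichever the
  order.\<close>
lemma above_last_class: "hat_less le (last_class le n) (hat s) \<longleftrightarrow> n < wlen s"
proof -
  let ?S = "hat ` {s :: 'a free_group. wlen s = n}"
  have "finite ?S"
    by (intro finite_imageI finite_subset[OF _ finite_wlen_le[of n]]) auto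
  moreover have "?S \<noteq> {}" using exists_wlen[where 'a = 'a, of n] by blast
  ultimately obtain \<nu> where \<nu>: "\<nu> \<in> ?S" "\<And>\<nu>'. \<nu>' \<in> ?S \<Longrightarrow> hat_le le \<nu>' \<nu>"
    using greatest_class[of ?S] by blast
  have "last_class le n = \<nu>"
    unfolding last_class_def
    by (rule the_equality) (use \<nu> hat_le_antisym in \<open>blast+\<close>)
  moreover obtain t where t: "wlen t = n" "\<nu> = hat t" using \<nu>(1) by blast
  ultimately have last: "last_class le n = hat t" by simp
  show ?thesis
  proof
    assume less: "hat_less le (last_class le n) (hat s)"
    have "wlen s \<noteq> n"
    proof
      assume "wlen s = n"
      then have "hat_le le (hat s) (hat t)" using \<nu>(2) t by blast
      then show False using less hat_le_antisym by (auto simp: last hat_less_def)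
    qed
    moreover have "n \<le> wlen s"
      using less wlen_mono t(1) by (auto simp: last hat_less_def)
    ultimately show "n < wlen s" by simp
  next
    assume "n < wlen s"
    then have "hat_le le (hat t) (hat s)" "hat t \<noteq> hat s"
      using t(1) hat_le_shorter wlen_least_rep by (auto, metis order_less_irrefl)
    then show "hat_less le (last_class le n) (hat s)"
      by (simp add: last hat_less_def)
  qed
qed

lemma clique_iff:
  "is_clique (graph_adj le \<mu>) C \<longleftrightarrow> (\<forall>s\<in>C. \<forall>t\<in>C. s \<noteq> t \<longrightarrow> hat_le le (hat (inverse s * t)) \<mu>)"
  by (auto simp: is_clique_def graph_adj_def)

lemma maximal_clique_extending:
  assumes "is_clique (graph_adj le (hat g)) C0" "1 \<in> C0"
  obtains C where "is_maximal_clique (graph_adj le (hat g)) C" "C0 \<subseteq> C"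
proof -
  let ?A = "{C. is_clique (graph_adj le (hat g)) C \<and> C0 \<subseteq> C}"
  have "wlen s \<le> wlen g" if "C \<in> ?A" "s \<in> C" for C s
  proof (cases "s = 1")
    case False
    moreover have "1 \<in> C" using that assms(2) by blast
    ultimately have "hat_le le (hat s) (hat g)"
      using that unfolding clique_iff by fastforce
    then show ?thesis by (rule wlen_mono)
  qed simp
  then have "?A \<subseteq> Pow {s. wlen s \<le> wlen g}" by blast
  then have "finite ?A"
    by (rule finite_subset) (simp add: finite_wlen_le)
  then have "\<exists>C\<in>?A. C0 \<subseteq> C \<and> (\<forall>C'\<in>?A. C \<subseteq> C' \<longrightarrow> C = C')"
    using assms(1) by (intro finite_has_maximal2) simp_all
  then obtain C where C: "is_clique (graph_adj le (hat g)) C" "C0 \<subseteq> C"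
    and max: "\<forall>C'\<in>?A. C \<subseteq> C' \<longrightarrow> C = C'"
    by auto
  have "C' = C" if "is_clique (graph_adj le (hat g)) C'" "C \<subseteq> C'" for C'
    using max that C(2) by auto
  then show ?thesis
    using C by (intro that[of C]) (simp_all add: is_maximal_clique_def)
qed

text \<open>A point of the lens has distance at most \<open>N\<close> from every point of \<open>C\<close>, so maximality forces it into
  \<open>C\<close>.\<close>
lemma maximal_clique_lens:
  assumes max: "is_maximal_clique (graph_adj le (hat (inverse u * v))) C"
    and C: "u \<in> C" "v \<in> C" and uv: "wdist u v = Suc N"
  shows "C \<subseteq> lens (Suc N) u v" and "lens N u v \<subseteq> C"
proof -
  have clique: "hat_le le (hat (inverse s * t)) (hat (inverse u * v))" if "s \<in> C" "t \<in> C" "s \<noteq> t" for s t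
    using max that by (simp add: is_maximal_clique_def clique_iff)
  have "wdist s t \<le> Suc N" if "s \<in> C" "t \<in> C" for s t
    using wlen_mono[OF clique[OF that]] uv by (cases "s = t") simp_all
  then show sub: "C \<subseteq> lens (Suc N) u v"
    using C by (auto simp: mem_lens)
  show "lens N u v \<subseteq> C"
  proof
    fix r assume r: "r \<in> lens N u v"
    have near: "hat_le le (hat (inverse r * t)) (hat (inverse u * v))" if "t \<in> C" for t
    proof -
      have "wdist r t \<le> N"
        using wdist_lens[OF r, of t "Suc N"] sub that uv by auto
      then show ?thesis using uv by (intro hat_le_shorter) simp
    qed
    have "is_clique (graph_adj le (hat (inverse u * v))) (insert r C)"
      unfolding clique_iff using near clique by (auto simp: hat_wdist_commute[of _ r])
    then have "insert r C = C"
      using max by (auto simp: is_maximal_clique_def)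
    then show "r \<in> C" by blast
  qed
qed

end

lemma lexicographic_length_first:
  assumes "lexicographic le"
  shows "length_first_order le"
proof -
  note parts = assms[unfolded lexicographic_def]
  show ?thesis
  proof
    show "linear_order {(s, t). le s t}"
      by (rule conjunct1[OF parts])
    show "le s t" if "wlen s < wlen t" for s t
      using conjunct1[OF conjunct2[OF parts]] that by simp
  qed
qed

section \<open>Central extensions and lenses\<close>

text \<open>For positive definite \<open>\<Phi>\<close> this says that \<^typ>\<open>'k\<close> is large enough. It keeps track of the space in which the
  parameters are formed, since a central extension comes with realizations in that type.\<close>
definition finitely_realizable ::
  "'k::chilbert_space itself \<Rightarrow> ('a free_group \<Rightarrow> 'h::chilbert_space \<Rightarrow> 'h) \<Rightarrow> bool" where
  "finitely_realizable _ \<Phi> \<longleftrightarrow>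
     (\<forall>F. finite F \<longrightarrow> (\<exists>\<omega> :: 'a free_group \<Rightarrow> 'h \<Rightarrow> 'k. realizes F (toeplitz \<Phi>) \<omega>))"

text \<open>The condition that replaces the vanishing of all parameters of words of length \<open>N + 1\<close>.\<close>
definition lens_orthogonal ::
  "'k::chilbert_space itself \<Rightarrow> nat \<Rightarrow> ('a free_group \<Rightarrow> 'h::chilbert_space \<Rightarrow> 'h) \<Rightarrow> bool" where
  "lens_orthogonal _ N \<Phi> \<longleftrightarrow>
     (\<forall>s t (\<omega> :: 'a free_group \<Rightarrow> 'h \<Rightarrow> 'k). wdist s t = Suc N \<longrightarrow>
        realizes (lens N s t \<union> {s, t}) (toeplitz \<Phi>) \<omega> \<longrightarrow> fam_orth \<omega> (lens N s t) s t)"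

lemma lens_orthogonalD:
  assumes "lens_orthogonal TYPE('k::chilbert_space) N \<Phi>" and "wdist s t = Suc N"
    and "realizes I (toeplitz \<Phi>) (\<omega> :: 'a free_group \<Rightarrow> 'h::chilbert_space \<Rightarrow> 'k)"
    and "lens N s t \<union> {s, t} \<subseteq> I"
  shows "fam_orth \<omega> (lens N s t) s t"
  using assms(1,2) realizes_mono[OF assms(3,4)] unfolding lens_orthogonal_def by simp

lemma fam_orth_translate:
  "fam_orth (\<lambda>s. \<omega> (g * s)) X u v \<longleftrightarrow> fam_orth \<omega> ((*) g ` X) (g * u) (g * v)"
  by simp

context length_first_order
begin

lemma hat_less_trans:
  "hat_less le (hat s) (hat t) \<Longrightarrow> hat_less le (hat t) (hat r) \<Longrightarrow> hat_less le (hat s) (hat r)"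
  unfolding hat_less_def using hat_le_trans hat_le_antisym by metis

text \<open>Interchanging the two points inverts \<open>inverse a * b\<close>, so the pair can be ordered such that the
  quotient is the least representative of its class.\<close>
lemma least_rep_of_pair:
  obtains u v where "{u, v} = {a, b}" "least_rep le (hat (inverse a * b)) = inverse u * v"
proof (cases "le (inverse a * b) (inverse (inverse a * b))")
  case True
  then show ?thesis by (intro that[of a b]) (simp_all add: least_rep_hat)
next
  case False
  then show ?thesis
    by (intro that[of b a]) (auto simp: least_rep_hat free_group.inverse_distrib_swap)
qed

lemma central_clique:
  fixes \<phi> \<Phi> :: "'a free_group \<Rightarrow> 'h::chilbert_space \<Rightarrow> 'h"
  assumes central: "is_central_extension TYPE('k::chilbert_space) le n \<phi> \<Phi>"
    and g: "n < wlen g" and C: "is_maximal_clique (graph_adj le (hat g)) C" "1 \<in> C" "least_rep le (hat g) \<in> C"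
  obtains \<omega> :: "'a free_group \<Rightarrow> 'h \<Rightarrow> 'k::chilbert_space" where "realizes C (toeplitz \<Phi>) \<omega>"
    "fam_orth \<omega> (C - {1, least_rep le (hat g)}) 1 (least_rep le (hat g))"
proof -
  have "hat_less le (last_class le n) (hat g)"
    using g by (simp add: above_last_class)
  then obtain \<omega> :: "'a free_group \<Rightarrow> 'h \<Rightarrow> 'k" where \<omega>: "realizes C (toeplitz \<Phi>) \<omega>"
    "\<forall>d\<in>D_space \<omega> C (least_rep le (hat g)). gamma \<omega> C (least_rep le (hat g)) d = 0"
    using central C unfolding is_central_extension_def by (metis rangeI)
  have "least_rep le (hat g) \<noteq> 1"
    using g wlen_least_rep[of g] by auto
  from gamma_eq_zero_iff[OF C(2,3) this, of \<omega>] show ?thesis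
    using \<omega> by (intro that) simp_all
qed

text \<open>The pair of \<open>F\<close> with the greatest class \<open>\<mu>\<close> makes \<open>F\<close> a clique of the graph of \<open>\<mu>\<close>. A translate of
  \<open>F\<close> contains the unit and the least representative of \<open>\<mu>\<close>, so it extends to one of the cliques for which
  the central extension provides a realization.\<close>
lemma central_finitely_realizable:
  fixes \<phi> \<Phi> :: "'a free_group \<Rightarrow> 'h::chilbert_space \<Rightarrow> 'h"
  assumes central: "is_central_extension TYPE('k::chilbert_space) le n \<phi> \<Phi>"
  shows "finitely_realizable TYPE('k) \<Phi>"
  unfolding finitely_realizable_def
proof (intro allI impI)
  fix F :: "'a free_group set" assume "finite F"
  obtain z :: "'a free_group" where z: "wlen z = Suc n" using exists_wlen by blast
  \<comment> \<open>The additional points make the greatest class one of words longer than \<open>n\<close>.\<close>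
  define F' where "F' = insert 1 (insert z F)"
  let ?S = "(\<lambda>(a, b). hat (inverse a * b)) ` (F' \<times> F')"
  have "finite ?S" "?S \<noteq> {}" using \<open>finite F\<close> by (auto simp: F'_def)
  from greatest_class[OF this] obtain a b where ab: "a \<in> F'" "b \<in> F'"
    and max: "\<And>s t. s \<in> F' \<Longrightarrow> t \<in> F' \<Longrightarrow> hat_le le (hat (inverse s * t)) (hat (inverse a * b))"
    by auto
  have "hat_le le (hat z) (hat (inverse a * b))"
    using max[of 1 z] by (simp add: F'_def)
  then have "Suc n \<le> wdist a b" using wlen_mono z by metis
  obtain u v where uv: "{u, v} = {a, b}" "least_rep le (hat (inverse a * b)) = inverse u * v"
    by (rule least_rep_of_pair)
  let ?g = "inverse a * b" and ?r = "inverse u * v" and ?C0 = "{s. u * s \<in> F'}"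
  have mem: "u \<in> F'" "v \<in> F'" using uv(1) ab by auto
  have "is_clique (graph_adj le (hat ?g)) ?C0"
    unfolding clique_iff using max by (metis inverse_mult_cancel mem_Collect_eq)
  moreover have C0: "1 \<in> ?C0" "?r \<in> ?C0" using mem by (simp_all add: mult.assoc[symmetric])
  ultimately obtain C where C: "is_maximal_clique (graph_adj le (hat ?g)) C" "?C0 \<subseteq> C"
    by (metis maximal_clique_extending)
  obtain \<omega> :: "'a free_group \<Rightarrow> 'h \<Rightarrow> 'k" where \<omega>: "realizes C (toeplitz \<Phi>) \<omega>"
  proof (rule central_clique[OF central _ C(1)])
    show "n < wlen ?g" using \<open>Suc n \<le> wdist a b\<close> by simp
    show "1 \<in> C" "least_rep le (hat ?g) \<in> C"
      unfolding uv(2) using C0 C(2) by (simp_all only: subset_eq)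
  qed
  have "realizes F (toeplitz \<Phi>) (\<lambda>s. \<omega> (inverse u * s))"
  proof (rule realizes_translate[OF \<omega>])
    fix s assume "s \<in> F"
    then have "u * (inverse u * s) \<in> F'" by (simp add: mult.assoc[symmetric] F'_def)
    then show "inverse u * s \<in> C" using C(2) by blast
  qed
  then show "\<exists>\<omega> :: 'a free_group \<Rightarrow> 'h \<Rightarrow> 'k. realizes F (toeplitz \<Phi>) \<omega>" by blast
qed

text \<open>By induction along the order of the classes. For the pair with class \<open>\<mu>\<close>, the vanishing of
  \<open>\<gamma>\<^sub>\<mu>\<close> gives orthogonality given the rest of a maximal clique \<open>C\<close>. Every other pair of \<open>C\<close> at distance \<open>N + 1\<close>
  has a class below \<open>\<mu>\<close>: it is at most \<open>\<mu>\<close> as \<open>C\<close> is a clique, and it is not \<open>\<mu>\<close> as a class occurs only once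
  among such pairs with the same midpoint. These pairs are orthogonal given the lens by induction, so
  \<open>C\<close> may be replaced by the lens.\<close>
lemma central_fam_orth:
  fixes \<phi> \<Phi> :: "'a free_group \<Rightarrow> 'h::chilbert_space \<Rightarrow> 'h"
    and \<omega> :: "'a free_group \<Rightarrow> 'h \<Rightarrow> 'k::chilbert_space"
  assumes central: "is_central_extension TYPE('k) le n \<phi> \<Phi>" and "n \<le> N"
    and st: "wdist s t = Suc N" and \<omega>: "realizes (lens (Suc N) s t) (toeplitz \<Phi>) \<omega>"
    and "a \<in> lens (Suc N) s t" "b \<in> lens (Suc N) s t" "wdist a b = Suc N"
  shows "fam_orth \<omega> (lens N s t) a b"
  using assms(5-7)
proof (induction "card {(c, d) \<in> lens (Suc N) s t \<times> lens (Suc N) s t.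
    hat_less le (hat (inverse c * d)) (hat (inverse a * b))}" arbitrary: a b rule: less_induct)
  case less
  let ?B = "lens (Suc N) s t"
  let ?below = "\<lambda>a b. {(c, d) \<in> ?B \<times> ?B. hat_less le (hat (inverse c * d)) (hat (inverse a * b))}"
  obtain u v where uv: "{u, v} = {a, b}" and rep: "least_rep le (hat (inverse a * b)) = inverse u * v"
    by (rule least_rep_of_pair)
  let ?r = "inverse u * v"
  have uvB: "u \<in> ?B" "v \<in> ?B" and duv: "wdist u v = Suc N"
    using uv less.prems by (auto simp: doubleton_eq_iff wdist_commute)
  have hat: "hat (inverse a * b) = hat ?r"
    using hat_least_rep[of "inverse a * b"] by (simp add: rep)
  have lens: "lens k u v = lens k s t" "lens k u v = (*) u ` lens k 1 ?r" for k
    using lens_eq[OF st duv uvB] by (simp_all add: translate_lens_image mult.assoc[symmetric])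
  have step: "fam_orth \<omega> (lens N s t) c d"
    if "c \<in> ?B" "d \<in> ?B" "wdist c d = Suc N" "hat_less le (hat (inverse c * d)) (hat ?r)" for c d
  proof (rule less.hyps[OF _ that(1-3)])
    have "?below c d \<subseteq> ?below a b"
      using hat_less_trans[OF _ that(4)] unfolding hat by auto
    moreover have "(c, d) \<in> ?below a b" "(c, d) \<notin> ?below c d"
      using that by (auto simp: hat hat_less_def)
    ultimately have "?below c d \<subset> ?below a b" by blast
    moreover have "finite (?below a b)"
      by (rule finite_subset[of _ "?B \<times> ?B"]) (auto simp: finite_lens)
    ultimately show "card (?below c d) < card (?below a b)"
      by (simp add: psubset_card_mono)
  qed
  have "hat_le le (hat (inverse ?r * 1)) (hat ?r)"
    by (simp add: hat_inverse hat_le_refl)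
  then have "is_clique (graph_adj le (hat ?r)) {1, ?r}"
    unfolding clique_iff by (simp add: hat_le_refl)
  then obtain C where "is_maximal_clique (graph_adj le (hat ?r)) C" and "{1, ?r} \<subseteq> C"
    by (rule maximal_clique_extending[OF _ insertI1])
  then have C: "is_maximal_clique (graph_adj le (hat ?r)) C" "1 \<in> C" "?r \<in> C" by simp_all
  have clique: "\<forall>c\<in>C. \<forall>d\<in>C. c \<noteq> d \<longrightarrow> hat_le le (hat (inverse c * d)) (hat ?r)"
    using C(1) unfolding is_maximal_clique_def clique_iff by (elim conjE)
  have sub: "C \<subseteq> lens (Suc N) 1 ?r" "lens N 1 ?r \<subseteq> C"
    using maximal_clique_lens[of 1 ?r C N] C duv by simp_all
  have CB: "u * c \<in> ?B" if "c \<in> C" for c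
    using that sub(1) lens[of "Suc N"] by blast
  \<comment> \<open>Translation by \<open>u\<close> moves the clique at the unit to the pair \<open>u\<close>, \<open>v\<close>.\<close>
  let ?\<eta> = "\<lambda>s. \<omega> (u * s)"
  have r: "n < wlen ?r" "least_rep le (hat ?r) = ?r"
    using \<open>n \<le> N\<close> duv rep by (simp_all add: hat)
  obtain \<omega>' :: "'a free_group \<Rightarrow> 'h \<Rightarrow> 'k" where \<omega>': "realizes C (toeplitz \<Phi>) \<omega>'"
    "fam_orth \<omega>' (C - {1, ?r}) 1 ?r"
    by (rule central_clique[OF central r(1) C(1,2), unfolded r(2), OF C(3)])
  have "realizes C (toeplitz \<Phi>) ?\<eta>"
    by (rule realizes_translate[OF \<omega> CB])
  then have "fam_orth ?\<eta> (C - {1, ?r}) 1 ?r"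
    using fam_orth_transfer[OF _ \<omega>'(1), of C ?\<eta> "C - {1, ?r}" 1 ?r] \<omega>'(2) C(2,3) by simp
  also have "fam_orth ?\<eta> (C - {1, ?r}) 1 ?r \<longleftrightarrow> fam_orth ?\<eta> (lens N 1 ?r) 1 ?r"
  proof (rule fam_orth_clique_iff[OF _ C(2,3) sub(2,1)])
    show "wdist 1 ?r = Suc N" using duv by simp
    fix c d assume cd: "c \<in> C" "d \<in> C" "wdist c d = Suc N" "{c, d} \<noteq> {1, ?r}"
    have "hat (inverse c * d) \<noteq> hat (inverse 1 * ?r)"
      using lens_pair_unique[of 1 ?r "Suc N" c d] cd sub(1) duv by auto
    moreover have "c \<noteq> d" using cd(3) by auto
    then have "hat_le le (hat (inverse c * d)) (hat ?r)"
      using clique cd(1,2) by blast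
    ultimately have "hat_less le (hat (inverse (u * c) * (u * d))) (hat ?r)"
      by (simp add: hat_less_def inverse_mult_cancel)
    then have "fam_orth \<omega> (lens N s t) (u * c) (u * d)"
      using cd by (intro step CB) (simp_all add: inverse_mult_cancel)
    then show "fam_orth ?\<eta> (lens N 1 ?r) c d"
      unfolding fam_orth_translate lens(2)[symmetric] lens(1) .
  qed
  finally have "fam_orth \<omega> (lens N s t) u v"
    unfolding fam_orth_translate lens(2)[symmetric] lens(1) by (simp add: mult.assoc[symmetric])
  then show ?case
    using uv fam_orth_commute[of \<omega> "lens N s t" u v] by (auto simp: doubleton_eq_iff)
qed

lemma central_lens_orthogonal:
  fixes \<phi> \<Phi> :: "'a free_group \<Rightarrow> 'h::chilbert_space \<Rightarrow> 'h"
  assumes central: "is_central_extension TYPE('k::chilbert_space) le n \<phi> \<Phi>" and "n \<le> N"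
  shows "lens_orthogonal TYPE('k) N \<Phi>"
  unfolding lens_orthogonal_def
proof (intro allI impI)
  fix s t and \<omega>' :: "'a free_group \<Rightarrow> 'h \<Rightarrow> 'k"
  assume st: "wdist s t = Suc N" and \<omega>': "realizes (lens N s t \<union> {s, t}) (toeplitz \<Phi>) \<omega>'"
  obtain \<omega> :: "'a free_group \<Rightarrow> 'h \<Rightarrow> 'k" where \<omega>: "realizes (lens (Suc N) s t) (toeplitz \<Phi>) \<omega>"
    using central_finitely_realizable[OF central] finite_lens unfolding finitely_realizable_def by blast
  have ends: "s \<in> lens (Suc N) s t" "t \<in> lens (Suc N) s t"
    using st by (simp_all add: ends_in_lens)
  have "fam_orth \<omega> (lens N s t) s t"
    by (rule central_fam_orth[OF central \<open>n \<le> N\<close> st \<omega> ends st])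
  moreover have "lens N s t \<union> {s, t} \<subseteq> lens (Suc N) s t"
    using ends by (auto simp: mem_lens)
  ultimately show "fam_orth \<omega>' (lens N s t) s t"
    using fam_orth_transfer[OF \<omega> \<omega>', of "lens N s t" s t] by simp
qed

text \<open>The converse replacement: all pairs of the clique at distance \<open>N + 1\<close> have the same lens and are
  orthogonal given it, so the lens may be enlarged to the rest of the clique.\<close>
lemma central_if_lens_orthogonal:
  fixes \<phi> \<Phi> :: "'a free_group \<Rightarrow> 'h::chilbert_space \<Rightarrow> 'h"
  assumes "pd_extension n \<phi> \<Phi>" and real: "finitely_realizable TYPE('k::chilbert_space) \<Phi>"
    and orth: "\<And>N. n \<le> N \<Longrightarrow> lens_orthogonal TYPE('k) N \<Phi>"
  shows "is_central_extension TYPE('k) le n \<phi> \<Phi>"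
proof -
  have "\<exists>\<omega> :: 'a free_group \<Rightarrow> 'h \<Rightarrow> 'k. realizes C (toeplitz \<Phi>) \<omega> \<and>
      (\<forall>d\<in>D_space \<omega> C (least_rep le \<mu>). gamma \<omega> C (least_rep le \<mu>) d = 0)"
    if \<mu>: "\<mu> \<in> range hat" "hat_less le (last_class le n) \<mu>"
      and C: "is_maximal_clique (graph_adj le \<mu>) C" "1 \<in> C" "least_rep le \<mu> \<in> C" for \<mu> C
  proof -
    let ?r = "least_rep le \<mu>"
    obtain N where N: "wlen ?r = Suc N" "n \<le> N" and hat: "hat (inverse 1 * ?r) = \<mu>"
    proof -
      from \<mu>(1) obtain g where g: "\<mu> = hat g" by blast
      then have "n < wlen g" using \<mu>(2) by (simp add: above_last_class)
      moreover from this obtain N where "wlen g = Suc N" by (cases "wlen g") simp_all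
      ultimately show ?thesis
        using that[of N] by (simp add: g wlen_least_rep hat_least_rep)
    qed
    have d: "wdist 1 ?r = Suc N" using N(1) by simp
    have "is_maximal_clique (graph_adj le (hat (inverse 1 * ?r))) C"
      unfolding hat by (rule C(1))
    from maximal_clique_lens[OF this C(2,3) d]
    have sub: "C \<subseteq> lens (Suc N) 1 ?r" "lens N 1 ?r \<subseteq> C" .
    have "finite C"
      using sub(1) by (rule finite_subset) (rule finite_lens)
    then obtain \<omega> :: "'a free_group \<Rightarrow> 'h \<Rightarrow> 'k" where \<omega>: "realizes C (toeplitz \<Phi>) \<omega>"
      using real unfolding finitely_realizable_def by blast
    have *: "fam_orth \<omega> (lens N 1 ?r) a b" if "a \<in> C" "b \<in> C" "wdist a b = Suc N" for a b
    proof -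
      have "lens N a b = lens N 1 ?r"
        using that sub(1) d by (intro lens_eq) auto
      then show ?thesis
        using lens_orthogonalD[OF orth[OF N(2)] that(3) \<omega>] that(1,2) sub(2) by simp
    qed
    have "fam_orth \<omega> (C - {1, ?r}) 1 ?r \<longleftrightarrow> fam_orth \<omega> (lens N 1 ?r) 1 ?r"
      by (rule fam_orth_clique_iff[OF d C(2,3) sub(2,1)]) (rule *)
    then have "fam_orth \<omega> (C - {1, ?r}) 1 ?r"
      using *[OF C(2,3) d] by simp
    moreover have "?r \<noteq> 1" using N(1) by auto
    ultimately show ?thesis
      using \<omega> gamma_eq_zero_iff[OF C(2,3), of \<omega>] by blast
  qed
  then show ?thesis
    unfolding is_central_extension_def using assms(1) by blast
qed

lemma central_extension_iff_lens_orthogonal: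
  fixes \<phi> \<Phi> :: "'a free_group \<Rightarrow> 'h::chilbert_space \<Rightarrow> 'h"
  shows "is_central_extension TYPE('k::chilbert_space) le n \<phi> \<Phi> \<longleftrightarrow>
    pd_extension n \<phi> \<Phi> \<and> finitely_realizable TYPE('k) \<Phi> \<and> (\<forall>N\<ge>n. lens_orthogonal TYPE('k) N \<Phi>)"
proof
  assume central: "is_central_extension TYPE('k) le n \<phi> \<Phi>"
  moreover from central have "pd_extension n \<phi> \<Phi>" by (simp add: is_central_extension_def)
  ultimately show "pd_extension n \<phi> \<Phi> \<and> finitely_realizable TYPE('k) \<Phi> \<and>
      (\<forall>N\<ge>n. lens_orthogonal TYPE('k) N \<Phi>)"
    using central_finitely_realizable central_lens_orthogonal by blast
qed (use central_if_lens_orthogonal in blast)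

end

text \<open>By induction on the length. If \<open>s\<close> has length \<open>N + 1\<close>, then all distances in the union of \<open>{s, 1}\<close> and
  the lens are at most \<open>N\<close>, except the one from \<open>s\<close> to \<open>1\<close>. So the Gram matrices agree apart from the entry
  \<open>\<Phi> s\<close>, and conditional orthogonality expresses this entry by the others.\<close>
lemma lens_orthogonal_unique:
  fixes \<Phi>1 \<Phi>2 :: "'a::finite free_group \<Rightarrow> 'h::chilbert_space \<Rightarrow> 'h"
  assumes ext: "pd_extension n \<phi> \<Phi>1" "pd_extension n \<phi> \<Phi>2"
    and real: "finitely_realizable TYPE('k::chilbert_space) \<Phi>1"
      "finitely_realizable TYPE('l::chilbert_space) \<Phi>2"
    and orth: "\<And>N. n \<le> N \<Longrightarrow> lens_orthogonal TYPE('k) N \<Phi>1"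
      "\<And>N. n \<le> N \<Longrightarrow> lens_orthogonal TYPE('l) N \<Phi>2"
  shows "\<Phi>1 = \<Phi>2"
proof
  fix s show "\<Phi>1 s = \<Phi>2 s"
  proof (induction "wlen s" arbitrary: s rule: less_induct)
    case less
    show ?case
    proof (cases "wlen s \<le> n")
      case True
      then show ?thesis using ext by (simp add: pd_extension_def word_ball_def)
    next
      case False
      then obtain N where N: "wlen s = Suc N" "n \<le> N" by (cases "wlen s") simp_all
      then have d: "wdist s 1 = Suc N" by simp
      let ?Z = "lens N s 1"
      have fin: "finite (?Z \<union> {s, 1})" by (simp add: finite_lens)
      obtain \<omega>1 :: "'a free_group \<Rightarrow> 'h \<Rightarrow> 'k" where \<omega>1: "realizes (?Z \<union> {s, 1}) (toeplitz \<Phi>1) \<omega>1"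
        using real(1) fin unfolding finitely_realizable_def by blast
      obtain \<omega>2 :: "'a free_group \<Rightarrow> 'h \<Rightarrow> 'l" where \<omega>2: "realizes (?Z \<union> {s, 1}) (toeplitz \<Phi>2) \<omega>2"
        using real(2) fin unfolding finitely_realizable_def by blast
      have near: "wdist i j \<le> N" if "i \<in> ?Z \<union> {1}" "j \<in> ?Z \<union> {s}" "i \<in> ?Z \<or> j \<in> ?Z" for i j
        using that wdist_lens[of i N s 1 j N] d by (auto simp: mem_lens)
      have eq: "toeplitz \<Phi>1 i j = toeplitz \<Phi>2 i j"
        if "i \<in> ?Z \<union> {1}" "j \<in> ?Z \<union> {s}" "i \<in> ?Z \<or> j \<in> ?Z" for i j
        using near[OF that] N by (intro less) simp
      have "cinner (\<Phi>1 s h) h' = cinner (\<Phi>2 s h) h'" for h h'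
      proof -
        have "fam_orth \<omega>1 ?Z s 1" "fam_orth \<omega>2 ?Z s 1"
          by (rule lens_orthogonalD[OF orth(1)[OF N(2)] d \<omega>1 order_refl]
              lens_orthogonalD[OF orth(2)[OF N(2)] d \<omega>2 order_refl])+
        then have "cinner (\<omega>1 s h) (\<omega>1 1 h') = cinner (\<omega>2 s h) (\<omega>2 1 h')"
          using cinner_oproj_realizations[OF \<omega>1 \<omega>2 eq, of h h'] unfolding cond_orth_iff by simp
        then show ?thesis
          using realizes_gram[OF \<omega>1, of 1 s h h'] realizes_gram[OF \<omega>2, of 1 s h h'] by simp
      qed
      then have "cinner (\<Phi>1 s h - \<Phi>2 s h) (\<Phi>1 s h - \<Phi>2 s h) = 0" for h
        by (simp add: cinner_diff_left)
      then show ?thesis by (simp add: cinner_self_eq_zero fun_eq_iff)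
    qed
  qed
qed

lemma dilation_realizes:
  assumes "minimal_naimark_dilation \<Phi> \<pi> V"
  shows "realizes I (toeplitz \<Phi>) (\<lambda>s h. \<pi> s (V h))"
proof -
  have unit: "unitary (\<pi> s)" and one: "\<pi> 1 = id" and mult: "\<pi> (s * t) = \<pi> s \<circ> \<pi> t"
    and V: "bounded_clinear V" and \<Phi>: "cinner (\<Phi> s h) h' = cinner (\<pi> s (V h)) (V h')" for s t h h'
    using assms by (simp_all add: minimal_naimark_dilation_def)
  have "bounded_clinear (\<lambda>h. \<pi> s (V h))" for s
    using unit[of s] V bounded_linear_compose[of "\<pi> s" V]
    by (simp add: unitary_def bounded_clinear_def)
  moreover have "cinner (\<Phi> (inverse s * t) h) h' = cinner (\<pi> t (V h)) (\<pi> s (V h'))" for s t h h'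
  proof -
    have "\<pi> s (\<pi> (inverse s * t) (V h)) = \<pi> t (V h)"
      using mult[of s "inverse s * t"] by (simp add: mult.assoc[symmetric] fun_eq_iff)
    then show ?thesis
      using unit[of s] unfolding \<Phi> by (metis unitary_def)
  qed
  ultimately show ?thesis by (simp add: realizes_def)
qed

text \<open>The dilation of the third part lives in a type of its own. Orthogonality is first obtained in the
  space of the parameters and then transferred to the dilation, which also realizes the kernel.\<close>
theorem theorem5p3:
  fixes \<phi> :: "'a::finite free_group \<Rightarrow> 'h::chilbert_space \<Rightarrow> 'h"
    and n :: nat
    and le1 le2 :: "'a free_group \<Rightarrow> 'a free_group \<Rightarrow> bool"
  assumes "n \<ge> 1"
    and "positive_definite (word_ball n) \<phi>"
    and "\<phi> 1 = id"
    and "lexicographic le1" and "lexicographic le2"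
  shows
    "(\<forall>\<Phi>. is_central_extension TYPE('k::chilbert_space) le1 n \<phi> \<Phi> \<longleftrightarrow>
           is_central_extension TYPE('k) le2 n \<phi> \<Phi>) \<and>
     (\<forall>\<Phi>1 \<Phi>2. is_central_extension TYPE('k) le1 n \<phi> \<Phi>1 \<and>
             is_central_extension TYPE('l::chilbert_space) le2 n \<phi> \<Phi>2 \<longrightarrow> \<Phi>1 = \<Phi>2) \<and>
     (\<forall>\<Phi> (\<pi> :: 'a free_group \<Rightarrow> 'm \<Rightarrow> 'm::chilbert_space) V.
        is_central_extension TYPE('k) le1 n \<phi> \<Phi> \<and> minimal_naimark_dilation \<Phi> \<pi> V \<longrightarrow>
        maximal_orthogonal_extension n \<phi> \<Phi> \<pi> V)"
proof -
  interpret le1: length_first_order le1 by (rule lexicographic_length_first) fact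
  interpret le2: length_first_order le2 by (rule lexicographic_length_first) fact
  note iff = le1.central_extension_iff_lens_orthogonal le2.central_extension_iff_lens_orthogonal
  have "maximal_orthogonal_extension n \<phi> \<Phi> \<pi> V"
    if central: "is_central_extension TYPE('k) le1 n \<phi> \<Phi>" and dil: "minimal_naimark_dilation \<Phi> \<pi> V"
    for \<Phi> and \<pi> :: "'a free_group \<Rightarrow> 'm \<Rightarrow> 'm" and V
  proof -
    have ext: "pd_extension n \<phi> \<Phi>" and real: "finitely_realizable TYPE('k) \<Phi>"
      and orth: "lens_orthogonal TYPE('k) n \<Phi>"
      using central by (simp_all add: iff)
    let ?\<eta> = "\<lambda>s h. \<pi> s (V h)"
    have space: "dilation_space \<pi> V X = closed_cspan (ranges ?\<eta> X)" for X
      by (simp add: dilation_space_def)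
    have orth': "orth_sets (dilation_space \<pi> V (lens n s t \<union> {s}) \<ominus> dilation_space \<pi> V (lens n s t))
        (dilation_space \<pi> V (lens n s t \<union> {t}) \<ominus> dilation_space \<pi> V (lens n s t))"
      if st: "wdist s t = n + 1" for s t
    proof -
      have "finite (lens n s t \<union> {s, t})" by (simp add: finite_lens)
      then obtain \<omega> :: "'a free_group \<Rightarrow> 'h \<Rightarrow> 'k" where
        \<omega>: "realizes (lens n s t \<union> {s, t}) (toeplitz \<Phi>) \<omega>"
        using real unfolding finitely_realizable_def by blast
      have "fam_orth \<omega> (lens n s t) s t"
        using st by (intro lens_orthogonalD[OF orth _ \<omega>]) simp_all
      then have "fam_orth ?\<eta> (lens n s t) s t"
        using fam_orth_transfer[OF \<omega> dilation_realizes[OF dil], of "lens n s t" s t UNIV] by simp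
      then show ?thesis
        unfolding cond_orth_def space by (simp add: Un_commute)
    qed
    show ?thesis
      unfolding maximal_orthogonal_extension_def Let_def lens_def[symmetric]
      using ext dil orth' by blast
  qed
  moreover have "\<Phi>1 = \<Phi>2"
    if "is_central_extension TYPE('k) le1 n \<phi> \<Phi>1" "is_central_extension TYPE('l) le2 n \<phi> \<Phi>2"
    for \<Phi>1 \<Phi>2
    using that unfolding iff by (intro lens_orthogonal_unique[of n \<phi> \<Phi>1 \<Phi>2]) blast+
  ultimately show ?thesis by (simp add: iff)
qed

end
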